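(* Let $H=\mathbb{C}[T]$ be the underlying Hopf algebra of the classical vertex group and let $H\text{-}\mathit{Mod}$ be the category of representations of $H$. Then the category of holomorphic vertex algebras is isomorphic to the category of $H$-invariant commutative algebras in $H\text{-}\mathit{Mod}$.
   Context: The Hopf algebra $H=\mathbb{C}[T]$ has basis $D^{(i)}=T^i/i!$, coproduct $\Delta(D^{(i)})=\sum_{p+q=i}D^{(p)}\otimes D^{(q)}$, counit $\epsilon(D^{(i)})=\delta_{i,0}$ and antipode $S(D^{(i)})=(-1)^iD^{(i)}$. $H\text{-}\mathit{Mod}$ is the category of all (not necessarily finite-dimensional) $H$-modules, with symmetric tensor product $\otimes_{\mathbb C}$, $H$ acting through $\Delta$, and unit $\mathbb{C}$ with $H$ acting through $\epsilon$. A commutative (associative) algebra in a symmetric tensor category consists of an object $A$, a multiplication $\mu:A\otimes A\to A$ invariant under the symmetry of the tensor product, and a unit $\eta:I\to A$ ($I$ the tensor unit), satisfying the usual associativity and unit axioms. An $H$-invariant commutative algebra in $H\text{-}\mathit{Mod}$ is one whose structure maps are $H$-invariant, i.e. $H$-linear (so $T\mu(a\otimes b)=\mu(Ta\otimes b)+\mu(a\otimes Tb)$); morphisms are morphisms of algebras in $H\text{-}\mathit{Mod}$. A holomorphic vertex algebra is a complex vector space $V$ with an endomorphism $T$, a vector $|0\rangle\in V$ and a linear map $Y(\cdot,x)\cdot:V\otimes V\to V[[x]]$ such that: $T|0\rangle=0$, $Y(|0\rangle,x)a=a$, $Y(a,x)|0\rangle|_{x=0}=a$ for all $a\in V$; $[T,Y(a,x)]=\partial_xY(a,x)$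 for all $a$; and for all $a,b\in V$ there is $N\gg0$ with $(x-y)^N[Y(a,x),Y(b,y)]=0$ (equivalently here, $Y(a,x)Y(b,y)=Y(b,y)Y(a,x)$). A morphism of holomorphic vertex algebras is a complex linear map taking vacuum to vacuum, commuting with the multiplications $Y$, and respecting the translation operators $T$. *)

theory Defs
  imports
    "HOL-Algebra.Algebraic_Closure_Type"
    "HOL-Library.Poly_Mapping"
    "HOL-Library.FuncSet"
    "HOL-Computational_Algebra.Polynomial"
begin

section \<open>Categories and their isomorphisms\<close>

text \<open>Hom-sets of different pairs of objects need not be disjoint, so composition and the
  action of a functor on morphisms carry the objects as arguments.\<close>

record ('o, 'm) category =
  Obj :: "'o set"
  Hom :: "'o \<Rightarrow> 'o \<Rightarrow> 'm set"
  Idt :: "'o \<Rightarrow> 'm"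
  Cmp :: "'o \<Rightarrow> 'o \<Rightarrow> 'o \<Rightarrow> 'm \<Rightarrow> 'm \<Rightarrow> 'm"

definition is_category :: "('o, 'm) category \<Rightarrow> bool" where
  "is_category C \<longleftrightarrow>
     (\<forall>x\<in>Obj C. Idt C x \<in> Hom C x x) \<and>
     (\<forall>x\<in>Obj C. \<forall>y\<in>Obj C. \<forall>z\<in>Obj C. \<forall>f\<in>Hom C x y. \<forall>g\<in>Hom C y z.
        Cmp C x y z g f \<in> Hom C x z) \<and>
     (\<forall>x\<in>Obj C. \<forall>y\<in>Obj C. \<forall>f\<in>Hom C x y.
        Cmp C x x y f (Idt C x) = f \<and> Cmp C x y y (Idt C y) f = f) \<and>
     (\<forall>w\<in>Obj C. \<forall>x\<in>Obj C. \<forall>y\<in>Obj C. \<forall>z\<in>Obj C.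
        \<forall>f\<in>Hom C w x. \<forall>g\<in>Hom C x y. \<forall>h\<in>Hom C y z.
        Cmp C w x z (Cmp C x y z h g) f = Cmp C w y z h (Cmp C w x y g f))"

definition is_functor ::
  "('o, 'm) category \<Rightarrow> ('p, 'n) category \<Rightarrow> ('o \<Rightarrow> 'p) \<Rightarrow> ('o \<Rightarrow> 'o \<Rightarrow> 'm \<Rightarrow> 'n) \<Rightarrow> bool" where
  "is_functor C D Fo Fm \<longleftrightarrow>
     (\<forall>x\<in>Obj C. Fo x \<in> Obj D) \<and>
     (\<forall>x\<in>Obj C. \<forall>y\<in>Obj C. \<forall>f\<in>Hom C x y. Fm x y f \<in> Hom D (Fo x) (Fo y)) \<and>
     (\<forall>x\<in>Obj C. Fm x x (Idt C x) = Idt D (Fo x)) \<and>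
     (\<forall>x\<in>Obj C. \<forall>y\<in>Obj C. \<forall>z\<in>Obj C. \<forall>f\<in>Hom C x y. \<forall>g\<in>Hom C y z.
        Fm x z (Cmp C x y z g f) = Cmp D (Fo x) (Fo y) (Fo z) (Fm y z g) (Fm x y f))"

definition isomorphic_categories :: "('o, 'm) category \<Rightarrow> ('p, 'n) category \<Rightarrow> bool" where
  "isomorphic_categories C D \<longleftrightarrow> is_category C \<and> is_category D \<and>
     (\<exists>Fo Fm Go Gm. is_functor C D Fo Fm \<and> is_functor D C Go Gm \<and>
        (\<forall>x\<in>Obj C. Go (Fo x) = x) \<and>
        (\<forall>x\<in>Obj C. \<forall>y\<in>Obj C. \<forall>f\<in>Hom C x y. Gm (Fo x) (Fo y) (Fm x y f) = f) \<and>
        (\<forall>x\<in>Obj D. Fo (Go x) = x) \<and>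
        (\<forall>x\<in>Obj D. \<forall>y\<in>Obj D. \<forall>f\<in>Hom D x y. Fm (Go x) (Go y) (Gm x y f) = f))"


section \<open>Linear maps\<close>

definition lin_hom ::
  "'r ring \<Rightarrow> ('r, 'a, 'm) module_scheme \<Rightarrow> ('r, 'b, 'n) module_scheme \<Rightarrow> ('a \<Rightarrow> 'b) set" where
  "lin_hom R M N = {f \<in> carrier M \<rightarrow>\<^sub>E carrier N.
     (\<forall>x\<in>carrier M. \<forall>y\<in>carrier M. f (x \<oplus>\<^bsub>M\<^esub> y) = f x \<oplus>\<^bsub>N\<^esub> f y) \<and>
     (\<forall>r\<in>carrier R. \<forall>x\<in>carrier M. f (r \<odot>\<^bsub>M\<^esub> x) = r \<odot>\<^bsub>N\<^esub> f x)}"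

text \<open>Equality of module records also sees the values of the operations outside the carrier and
  the fields \<open>mult\<close> and \<open>one\<close>, which \<open>module\<close> inherits from \<open>ring\<close> but which
  carry no information. Pinning them down makes record equality the equality of modules, as
  is required for an isomorphism (rather than an equivalence) of categories. The ring of scalars is
  always the whole type \<open>'r\<close>.\<close>

definition normalized :: "('r, 'v, 'm) module_scheme \<Rightarrow> bool" where
  "normalized M \<longleftrightarrow> monoid.mult M = undefined \<and> monoid.one M = undefined \<and>
     case_prod (ring.add M) \<in> extensional (carrier M \<times> carrier M) \<and>
     case_prod (module.smult M) \<in> extensional (UNIV \<times> carrier M)"


section \<open>Holomorphic vertex algebras\<close>

text \<open>\<open>vop V a b n\<close> is the coefficient of \<open>x ^ n\<close> in \<open>Y(a,x)b\<close>. A linear map on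
  \<open>V \<otimes> V\<close> is given by a bilinear map.\<close>

record 'v vertex_algebra = "(complex, 'v) module" +
  trans :: "'v \<Rightarrow> 'v"
  vac :: 'v
  vop :: "'v \<Rightarrow> 'v \<Rightarrow> nat \<Rightarrow> 'v"

abbreviation C_ring :: "complex ring" where
  "C_ring \<equiv> ring_of_type_algebra"

text \<open>Multiplication by \<open>x - y\<close> of the series in \<open>V[[x,y]]\<close> whose
  coefficient of \<open>x ^ m * y ^ n\<close> is \<open>F m n\<close>.\<close>

definition mult_x_minus_y ::
  "('r, 'v, 'm) module_scheme \<Rightarrow> (nat \<Rightarrow> nat \<Rightarrow> 'v) \<Rightarrow> nat \<Rightarrow> nat \<Rightarrow> 'v" where
  "mult_x_minus_y V F = (\<lambda>m n.
     (if m = 0 then \<zero>\<^bsub>V\<^esub> else F (m - 1) n) \<ominus>\<^bsub>V\<^esub> (if n = 0 then \<zero>\<^bsub>V\<^esub> else F m (n - 1)))"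

text \<open>The coefficients of \<open>[Y(a,x), Y(b,y)]c\<close>.\<close>

definition vcommutator ::
  "'v vertex_algebra \<Rightarrow> 'v \<Rightarrow> 'v \<Rightarrow> 'v \<Rightarrow> nat \<Rightarrow> nat \<Rightarrow> 'v" where
  "vcommutator V a b c = (\<lambda>m n. vop V a (vop V b c n) m \<ominus>\<^bsub>V\<^esub> vop V b (vop V a c m) n)"

definition holomorphic_vertex_algebra :: "'v vertex_algebra \<Rightarrow> bool" where
  "holomorphic_vertex_algebra V \<longleftrightarrow>
     Module.module C_ring V \<and>
     trans V \<in> lin_hom C_ring V V \<and>
     vac V \<in> carrier V \<and>
     (\<forall>n. \<forall>b\<in>carrier V. (\<lambda>a\<in>carrier V. vop V a b n) \<in> lin_hom C_ring V V) \<and>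
     (\<forall>n. \<forall>a\<in>carrier V. (\<lambda>b\<in>carrier V. vop V a b n) \<in> lin_hom C_ring V V) \<and>
     trans V (vac V) = \<zero>\<^bsub>V\<^esub> \<and>
     (\<forall>a\<in>carrier V. \<forall>n. vop V (vac V) a n = (if n = 0 then a else \<zero>\<^bsub>V\<^esub>)) \<and>
     (\<forall>a\<in>carrier V. vop V a (vac V) 0 = a) \<and>
     (\<forall>a\<in>carrier V. \<forall>b\<in>carrier V. \<forall>n.
        trans V (vop V a b n) \<ominus>\<^bsub>V\<^esub> vop V a (trans V b) n
        = of_nat (n + 1) \<odot>\<^bsub>V\<^esub> vop V a b (n + 1)) \<and>
     (\<forall>a\<in>carrier V. \<forall>b\<in>carrier V. \<exists>N. \<forall>c\<in>carrier V.
        (mult_x_minus_y V ^^ N) (vcommutator V a b c) = (\<lambda>m n. \<zero>\<^bsub>V\<^esub>))"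

definition va_hom :: "'v vertex_algebra \<Rightarrow> 'v vertex_algebra \<Rightarrow> ('v \<Rightarrow> 'v) set" where
  "va_hom V W = {f \<in> lin_hom C_ring V W.
     f (vac V) = vac W \<and>
     (\<forall>a\<in>carrier V. \<forall>b\<in>carrier V. \<forall>n. f (vop V a b n) = vop W (f a) (f b) n) \<and>
     (\<forall>a\<in>carrier V. f (trans V a) = trans W (f a))}"

text \<open>All holomorphic vertex algebras whose underlying set lies in the universe \<open>'v\<close>.\<close>

definition HolVA :: "('v vertex_algebra, 'v \<Rightarrow> 'v) category" where
  "HolVA = \<lparr>
     Obj = {V. holomorphic_vertex_algebra V \<and> normalized V \<and>
               case_prod (vop V) \<in> extensional (carrier V \<times> carrier V)},
     Hom = va_hom,
     Idt = (\<lambda>V. \<lambda>a\<in>carrier V. a),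
     Cmp = (\<lambda>U V W g f. compose (carrier U) g f)\<rparr>"


section \<open>Modules over the Hopf algebra \<open>\<complex>[T]\<close> and their tensor product\<close>

type_synonym 'v hmodule = "(complex poly, 'v) module"

abbreviation H_ring :: "complex poly ring" where
  "H_ring \<equiv> ring_of_type_algebra"

text \<open>The basis element \<open>D\<^sup>(\<^sup>i\<^sup>) = T ^ i / i!\<close>; thus
  \<open>h = (\<Sum>i. (fact i * coeff h i) * D\<^sup>(\<^sup>i\<^sup>))\<close>.\<close>

definition divpow :: "nat \<Rightarrow> complex poly" where
  "divpow i = monom (1 / fact i) i"

definition counit :: "complex poly \<Rightarrow> complex" where
  "counit h = coeff h 0"

definition unit_module :: "complex hmodule" where
  "unit_module = \<lparr>carrier = UNIV, monoid.mult = undefined, one = undefined, zero = 0, add = (+),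
     module.smult = (\<lambda>h z. counit h * z)\<rparr>"

text \<open>\<open>A \<otimes> B\<close> is the quotient of the complex vector space with basis
  \<open>carrier A \<times> carrier B\<close> by the relations of bilinearity; its elements are cosets.\<close>

type_synonym ('a, 'b) tensor = "('a \<times> 'b \<Rightarrow>\<^sub>0 complex) set"

definition pm_scale :: "complex \<Rightarrow> ('k \<Rightarrow>\<^sub>0 complex) \<Rightarrow> 'k \<Rightarrow>\<^sub>0 complex" where
  "pm_scale c f = Poly_Mapping.map ((*) c) f"

abbreviation pm_basis :: "'k \<Rightarrow> 'k \<Rightarrow>\<^sub>0 complex" where
  "pm_basis k \<equiv> Poly_Mapping.single k 1"

inductive_set bilinear_rels :: "'a hmodule \<Rightarrow> 'b hmodule \<Rightarrow> ('a \<times> 'b \<Rightarrow>\<^sub>0 complex) set"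
  for A :: "'a hmodule" and B :: "'b hmodule" where
  zero: "0 \<in> bilinear_rels A B"
| add: "f \<in> bilinear_rels A B \<Longrightarrow> g \<in> bilinear_rels A B \<Longrightarrow> f + g \<in> bilinear_rels A B"
| scale: "f \<in> bilinear_rels A B \<Longrightarrow> pm_scale c f \<in> bilinear_rels A B"
| add_left: "a \<in> carrier A \<Longrightarrow> a' \<in> carrier A \<Longrightarrow> b \<in> carrier B \<Longrightarrow>
    pm_basis (a \<oplus>\<^bsub>A\<^esub> a', b) - pm_basis (a, b) - pm_basis (a', b) \<in> bilinear_rels A B"
| add_right: "a \<in> carrier A \<Longrightarrow> b \<in> carrier B \<Longrightarrow> b' \<in> carrier B \<Longrightarrow>
    pm_basis (a, b \<oplus>\<^bsub>B\<^esub> b') - pm_basis (a, b) - pm_basis (a, b') \<in> bilinear_rels A B"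
| scale_left: "a \<in> carrier A \<Longrightarrow> b \<in> carrier B \<Longrightarrow>
    pm_basis ([:c:] \<odot>\<^bsub>A\<^esub> a, b) - pm_scale c (pm_basis (a, b)) \<in> bilinear_rels A B"
| scale_right: "a \<in> carrier A \<Longrightarrow> b \<in> carrier B \<Longrightarrow>
    pm_basis (a, [:c:] \<odot>\<^bsub>B\<^esub> b) - pm_scale c (pm_basis (a, b)) \<in> bilinear_rels A B"

definition tensor_class ::
  "'a hmodule \<Rightarrow> 'b hmodule \<Rightarrow> ('a \<times> 'b \<Rightarrow>\<^sub>0 complex) \<Rightarrow> ('a, 'b) tensor" where
  "tensor_class A B f = {f + r | r. r \<in> bilinear_rels A B}"

definition pure :: "'a hmodule \<Rightarrow> 'b hmodule \<Rightarrow> 'a \<Rightarrow> 'b \<Rightarrow> ('a, 'b) tensor" where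
  "pure A B a b = tensor_class A B (pm_basis (a, b))"

text \<open>The action of \<open>h\<close> through the coproduct, \<open>\<Delta>(D\<^sup>(\<^sup>i\<^sup>)) = \<Sum>p+q=i. D\<^sup>(\<^sup>p\<^sup>) \<otimes> D\<^sup>(\<^sup>q\<^sup>)\<close>,
  first on a basis vector and then on the free vector space.\<close>

definition coproduct_act_basis ::
  "'a hmodule \<Rightarrow> 'b hmodule \<Rightarrow> complex poly \<Rightarrow> 'a \<times> 'b \<Rightarrow> ('a \<times> 'b \<Rightarrow>\<^sub>0 complex)" where
  "coproduct_act_basis A B h k = (\<Sum>i\<le>Polynomial.degree h. pm_scale (fact i * coeff h i)
     (\<Sum>p\<le>i. pm_basis (divpow p \<odot>\<^bsub>A\<^esub> fst k, divpow (i - p) \<odot>\<^bsub>B\<^esub> snd k)))"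

definition coproduct_act ::
  "'a hmodule \<Rightarrow> 'b hmodule \<Rightarrow> complex poly \<Rightarrow> ('a \<times> 'b \<Rightarrow>\<^sub>0 complex) \<Rightarrow> ('a \<times> 'b \<Rightarrow>\<^sub>0 complex)" where
  "coproduct_act A B h f =
     (\<Sum>k\<in>Poly_Mapping.keys f. pm_scale (Poly_Mapping.lookup f k) (coproduct_act_basis A B h k))"

definition tensor_module :: "'a hmodule \<Rightarrow> 'b hmodule \<Rightarrow> ('a, 'b) tensor hmodule" where
  "tensor_module A B = \<lparr>
     carrier = {tensor_class A B f | f. Poly_Mapping.keys f \<subseteq> carrier A \<times> carrier B},
     monoid.mult = undefined, one = undefined,
     zero = tensor_class A B 0,
     add = (\<lambda>u v. {f + g | f g. f \<in> u \<and> g \<in> v}),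
     module.smult = (\<lambda>h u. \<Union>f\<in>u. tensor_class A B (coproduct_act A B h f))\<rparr>"

text \<open>The linear map on a tensor product with \<open>a \<otimes> b \<mapsto> \<beta> a b\<close>, for \<open>\<beta>\<close> bilinear with
  values in \<open>W\<close>: the linear extension of \<open>\<beta>\<close> to the free vector space is constant on cosets.\<close>

definition linear_extension ::
  "'w hmodule \<Rightarrow> ('a \<Rightarrow> 'b \<Rightarrow> 'w) \<Rightarrow> ('a \<times> 'b \<Rightarrow>\<^sub>0 complex) \<Rightarrow> 'w" where
  "linear_extension W \<beta> f =
     (\<Oplus>\<^bsub>W\<^esub>k\<in>Poly_Mapping.keys f. [:Poly_Mapping.lookup f k:] \<odot>\<^bsub>W\<^esub> \<beta> (fst k) (snd k))"

definition tensor_lift ::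
  "'w hmodule \<Rightarrow> ('a \<Rightarrow> 'b \<Rightarrow> 'w) \<Rightarrow> ('a, 'b) tensor \<Rightarrow> 'w" where
  "tensor_lift W \<beta> u = the_elem (linear_extension W \<beta> ` u)"

text \<open>The tensor product \<open>f \<otimes> g\<close> of maps to \<open>A'\<close> and \<open>B'\<close>, the symmetry, the
  associator \<open>(A \<otimes> B) \<otimes> C \<rightarrow> A \<otimes> (B \<otimes> C)\<close> and the unitors
  \<open>I \<otimes> A \<rightarrow> A\<close> and \<open>A \<otimes> I \<rightarrow> A\<close>.\<close>

definition tensor_map ::
  "'c hmodule \<Rightarrow> 'd hmodule \<Rightarrow> ('a \<Rightarrow> 'c) \<Rightarrow> ('b \<Rightarrow> 'd) \<Rightarrow> ('a, 'b) tensor \<Rightarrow> ('c, 'd) tensor" where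
  "tensor_map A' B' f g = tensor_lift (tensor_module A' B') (\<lambda>a b. pure A' B' (f a) (g b))"

definition symmetry :: "'a hmodule \<Rightarrow> 'b hmodule \<Rightarrow> ('a, 'b) tensor \<Rightarrow> ('b, 'a) tensor" where
  "symmetry A B = tensor_lift (tensor_module B A) (\<lambda>a b. pure B A b a)"

definition associator :: "'a hmodule \<Rightarrow> 'b hmodule \<Rightarrow> 'c hmodule \<Rightarrow>
    (('a, 'b) tensor, 'c) tensor \<Rightarrow> ('a, ('b, 'c) tensor) tensor" where
  "associator A B C = tensor_lift (tensor_module A (tensor_module B C))
     (\<lambda>u c. tensor_lift (tensor_module A (tensor_module B C))
        (\<lambda>a b. pure A (tensor_module B C) a (pure B C b c)) u)"

definition left_unitor :: "'a hmodule \<Rightarrow> (complex, 'a) tensor \<Rightarrow> 'a" where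
  "left_unitor A = tensor_lift A (\<lambda>z a. [:z:] \<odot>\<^bsub>A\<^esub> a)"

definition right_unitor :: "'a hmodule \<Rightarrow> ('a, complex) tensor \<Rightarrow> 'a" where
  "right_unitor A = tensor_lift A (\<lambda>a z. [:z:] \<odot>\<^bsub>A\<^esub> a)"


section \<open>Invariant commutative algebras in \<open>H-Mod\<close>\<close>

record 'v halgebra =
  hmod :: "'v hmodule"
  hmult :: "('v, 'v) tensor \<Rightarrow> 'v"
  hunit :: "complex \<Rightarrow> 'v"

definition comm_halgebra :: "'v halgebra \<Rightarrow> bool" where
  "comm_halgebra \<A> \<longleftrightarrow>
     (let A = hmod \<A>; \<mu> = hmult \<A>; \<eta> = hunit \<A>; I = unit_module; AA = tensor_module A A in
        Module.module H_ring A \<and>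
        \<mu> \<in> lin_hom H_ring AA A \<and>
        \<eta> \<in> lin_hom H_ring I A \<and>
        (\<forall>u\<in>carrier AA. \<mu> (symmetry A A u) = \<mu> u) \<and>
        (\<forall>u\<in>carrier (tensor_module AA A).
           \<mu> (tensor_map A A \<mu> (\<lambda>a. a) u) = \<mu> (tensor_map A A (\<lambda>a. a) \<mu> (associator A A A u))) \<and>
        (\<forall>u\<in>carrier (tensor_module I A). \<mu> (tensor_map A A \<eta> (\<lambda>a. a) u) = left_unitor A u) \<and>
        (\<forall>u\<in>carrier (tensor_module A I). \<mu> (tensor_map A A (\<lambda>a. a) \<eta> u) = right_unitor A u))"

definition halgebra_hom :: "'v halgebra \<Rightarrow> 'v halgebra \<Rightarrow> ('v \<Rightarrow> 'v) set" where
  "halgebra_hom \<A> \<B> = {f \<in> lin_hom H_ring (hmod \<A>) (hmod \<B>).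
     (\<forall>u\<in>carrier (tensor_module (hmod \<A>) (hmod \<A>)).
        f (hmult \<A> u) = hmult \<B> (tensor_map (hmod \<B>) (hmod \<B>) f f u)) \<and>
     (\<forall>z. f (hunit \<A> z) = hunit \<B> z)}"

text \<open>All such algebras whose underlying set lies in the universe \<open>'v\<close>.\<close>

definition HCommAlg :: "('v halgebra, 'v \<Rightarrow> 'v) category" where
  "HCommAlg = \<lparr>
     Obj = {\<A>. comm_halgebra \<A> \<and> normalized (hmod \<A>)},
     Hom = halgebra_hom,
     Idt = (\<lambda>\<A>. \<lambda>a\<in>carrier (hmod \<A>). a),
     Cmp = (\<lambda>\<A> \<B> \<C> g f. compose (carrier (hmod \<A>)) g f)\<rparr>"

end

theory Submission
  imports Defs
begin

text \<open>Both categories are compared with commutative complex algebras with a derivation \<open>T\<close>.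

  In a holomorphic vertex algebra locality means that fields commute: \<open>x - y\<close> is not a zero divisor
  on power series (\<open>funpow_mult_x_minus_y_eq_0D\<close>, \<open>Y_commute\<close>). Let \<open>a b\<close> be the constant term of
  \<open>Y(a,x)b\<close>. Applying commuting fields to the vacuum gives commutativity, hence associativity, of
  this product. The translation axiom forces \<open>Y(a,x)|0> = (\<Sum>n. D\<^sup>(\<^sup>n\<^sup>) a x\<^sup>n)\<close>, and commuting
  \<open>Y(a,x)\<close> past the constant term of \<open>Y(b,y)\<close> gives \<open>Y(a,x)b = (\<Sum>n. (D\<^sup>(\<^sup>n\<^sup>) a) b x\<^sup>n)\<close>
  (\<open>Y_eq_prod\<close>). So \<open>Y\<close> is determined by the product and \<open>T\<close>. The constant term of the translation
  axiom says that \<open>T\<close> is a derivation, and conversely the formula for \<open>Y\<close> defines a holomorphic vertex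
  algebra on any commutative algebra with derivation (\<open>holomorphic_vertex_algebra_of\<close>).

  On the other side a complex vector space with an endomorphism \<open>T\<close> is a module over \<open>\<complex>[T]\<close>, and by the
  universal property of the tensor product (\<open>tensor_lift\<close>, \<open>tensor_eqI\<close>) the diagrams for an algebra
  in \<open>H-Mod\<close> are identities between elements. Invariance of the multiplication under \<open>T\<close> is the derivation
  rule. Invariance under all of \<open>H\<close> then follows because the coproduct of \<open>D\<^sup>(\<^sup>n\<^sup>)\<close> encodes the iterated
  Leibniz rule (\<open>divpow_leibniz\<close>, \<open>act_m\<close>, \<open>lift_invariant\<close>).

  The two constructions are inverse to each other on the nose, and a map is a morphism of vertex
  algebras exactly if it is a morphism of algebras (\<open>va_hom_eq_halgebra_hom\<close>), so the functors do not
  change the underlying functions of morphisms.\<close>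


section \<open>Finitely supported functions\<close>

lemma lookup_pm_scale [simp]: "Poly_Mapping.lookup (pm_scale c f) k = c * Poly_Mapping.lookup f k"
  by (simp add: pm_scale_def map.rep_eq when_def)

lemma keys_pm_scale: "Poly_Mapping.keys (pm_scale c f) \<subseteq> Poly_Mapping.keys f"
  by (auto simp: in_keys_iff)

lemma pm_scale_add: "pm_scale c (f + g) = pm_scale c f + pm_scale c g"
  by (rule poly_mapping_eqI) (simp add: lookup_add distrib_left)

lemma pm_scale_diff: "pm_scale c (f - g) = pm_scale c f - pm_scale c g"
  by (rule poly_mapping_eqI) (simp add: lookup_minus right_diff_distrib)

lemma pm_scale_scale: "pm_scale c (pm_scale d f) = pm_scale (c * d) f"
  by (rule poly_mapping_eqI) simp

lemma pm_scale_add_left: "pm_scale (c + d) f = pm_scale c f + pm_scale d f"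
  by (rule poly_mapping_eqI) (simp add: lookup_add distrib_right)

lemma pm_scale_one [simp]: "pm_scale 1 f = f"
  by (rule poly_mapping_eqI) simp

lemma pm_scale_zero [simp]: "pm_scale 0 f = 0" "pm_scale c 0 = 0"
  by (rule poly_mapping_eqI; simp)+

lemma pm_scale_uminus_one: "pm_scale (-1) f = - f"
  by (rule poly_mapping_eqI) simp

lemma pm_scale_sum: "pm_scale c (\<Sum>i\<in>I. F i) = (\<Sum>i\<in>I. pm_scale c (F i))"
  by (rule poly_mapping_eqI) (simp add: lookup_sum sum_distrib_left)

lemma pm_basis_expansion:
  "f = (\<Sum>k\<in>Poly_Mapping.keys f. pm_scale (Poly_Mapping.lookup f k) (pm_basis k))"
proof (rule poly_mapping_eqI)
  fix k
  have "Poly_Mapping.lookup (\<Sum>k\<in>Poly_Mapping.keys f. pm_scale (Poly_Mapping.lookup f k) (pm_basis k)) k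
      = (\<Sum>l\<in>Poly_Mapping.keys f. if l = k then Poly_Mapping.lookup f l else 0)"
    unfolding lookup_sum by (rule sum.cong) (auto simp: lookup_single when_def)
  then show "Poly_Mapping.lookup f k =
      Poly_Mapping.lookup (\<Sum>k\<in>Poly_Mapping.keys f. pm_scale (Poly_Mapping.lookup f k) (pm_basis k)) k"
    by (simp add: in_keys_iff)
qed

lemma free_induct [consumes 1, case_names zero add scale basis]:
  assumes f: "Poly_Mapping.keys f \<subseteq> K"
    and zero: "P 0"
    and add: "\<And>f g. Poly_Mapping.keys f \<subseteq> K \<Longrightarrow> Poly_Mapping.keys g \<subseteq> K \<Longrightarrow> P f \<Longrightarrow> P g \<Longrightarrow> P (f + g)"
    and scale: "\<And>c f. Poly_Mapping.keys f \<subseteq> K \<Longrightarrow> P f \<Longrightarrow> P (pm_scale c f)"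
    and basis: "\<And>k. k \<in> K \<Longrightarrow> P (pm_basis k)"
  shows "P f"
proof -
  have b: "Poly_Mapping.keys (pm_scale c (pm_basis k)) \<subseteq> K" if "k \<in> K" for c k
    using that keys_pm_scale[of c "pm_basis k"] by auto
  have "Poly_Mapping.keys (\<Sum>k\<in>S. pm_scale (c k) (pm_basis k)) \<subseteq> K \<and>
      P (\<Sum>k\<in>S. pm_scale (c k) (pm_basis k))" if "finite S" "S \<subseteq> K" for S c
    using that
  proof (induction S rule: finite_induct)
    case empty
    then show ?case by (simp add: zero)
  next
    case (insert k S)
    let ?s = "\<Sum>k\<in>S. pm_scale (c k) (pm_basis k)"
    have "Poly_Mapping.keys ?s \<subseteq> K" "P ?s" and k: "k \<in> K"
      using insert by auto
    moreover have "P (pm_scale (c k) (pm_basis k))"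
      by (rule scale) (use k in \<open>auto intro: basis\<close>)
    moreover note b[OF k, of "c k"]
    moreover have "Poly_Mapping.keys (pm_scale (c k) (pm_basis k) + ?s) \<subseteq> K"
      using keys_add[of "pm_scale (c k) (pm_basis k)" ?s] calculation by blast
    ultimately show ?case
      using insert.hyps by (simp add: add)
  qed
  from this[OF _ f, of "Poly_Mapping.lookup f"] show ?thesis
    using pm_basis_expansion[of f] by simp
qed

text \<open>The linear extension of a map on basis vectors with values in a free vector space; the
  action through the coproduct has this form.\<close>

definition free_extension :: "('k \<Rightarrow> ('l \<Rightarrow>\<^sub>0 complex)) \<Rightarrow> ('k \<Rightarrow>\<^sub>0 complex) \<Rightarrow> ('l \<Rightarrow>\<^sub>0 complex)" where
  "free_extension F f =
     (\<Sum>k\<in>Poly_Mapping.keys f. pm_scale (Poly_Mapping.lookup f k) (F k))"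

lemma free_extension_superset:
  assumes "finite S" "Poly_Mapping.keys f \<subseteq> S"
  shows "free_extension F f = (\<Sum>k\<in>S. pm_scale (Poly_Mapping.lookup f k) (F k))"
  unfolding free_extension_def
  by (rule sum.mono_neutral_left) (use assms in \<open>auto simp: in_keys_iff\<close>)

lemma free_extension_add: "free_extension F (f + g) = free_extension F f + free_extension F g"
proof -
  let ?S = "Poly_Mapping.keys f \<union> Poly_Mapping.keys g"
  note s = free_extension_superset[of ?S _ F]
  show ?thesis
    using keys_add[of f g]
    by (simp add: s lookup_add pm_scale_add_left sum.distrib)
qed

lemma free_extension_scale: "free_extension F (pm_scale c f) = pm_scale c (free_extension F f)"
  using free_extension_superset[of "Poly_Mapping.keys f" _ F] keys_pm_scale[of c f]
  by (simp add: pm_scale_sum pm_scale_scale)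

lemma free_extension_zero [simp]: "free_extension F 0 = 0"
  by (simp add: free_extension_def)

lemma free_extension_diff: "free_extension F (f - g) = free_extension F f - free_extension F g"
  using free_extension_add[of F "f - g" g] by simp

lemma free_extension_basis [simp]: "free_extension F (pm_basis k) = F k"
  by (simp add: free_extension_def)

lemma coproduct_act_eq: "coproduct_act A B h = free_extension (coproduct_act_basis A B h)"
  by (simp add: coproduct_act_def free_extension_def fun_eq_iff)


section \<open>Complex vector spaces and their tensor product\<close>

text \<open>The scalar \<open>c\<close> acts as the constant polynomial \<open>[:c:]\<close>. Working with the underlying complex
  vector space means that the tensor product may be iterated, as in the associativity axiom, once it is
  known to be a vector space; that it is a module over \<open>\<complex>[T]\<close> has not to be proved first.\<close>

locale complex_space = abelian_group W for W :: "'w hmodule" (structure) +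
  assumes scale_closed [simp, intro]: "x \<in> carrier W \<Longrightarrow> [:c:] \<odot> x \<in> carrier W"
    and scale_l_distr: "x \<in> carrier W \<Longrightarrow> [:c + d:] \<odot> x = [:c:] \<odot> x \<oplus> [:d:] \<odot> x"
    and scale_r_distr: "x \<in> carrier W \<Longrightarrow> y \<in> carrier W \<Longrightarrow>
      [:c:] \<odot> (x \<oplus> y) = [:c:] \<odot> x \<oplus> [:c:] \<odot> y"
    and scale_assoc: "x \<in> carrier W \<Longrightarrow> [:c * d:] \<odot> x = [:c:] \<odot> ([:d:] \<odot> x)"
    and scale_one [simp]: "x \<in> carrier W \<Longrightarrow> 1 \<odot> x = x"
begin

lemma scale_zero_left [simp]: "x \<in> carrier W \<Longrightarrow> 0 \<odot> x = \<zero>"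
  using scale_l_distr[of x 0 0] scale_closed[of x 0] add.r_cancel_one'[of "0 \<odot> x" "0 \<odot> x"]
  by simp

lemma scale_zero_right [simp]: "[:c:] \<odot> \<zero> = \<zero>"
  using scale_r_distr[of \<zero> \<zero> c] scale_closed[of \<zero> c]
    add.r_cancel_one'[of "[:c:] \<odot> \<zero>" "[:c:] \<odot> \<zero>"]
  by simp

lemma finsum_scale:
  assumes "finite S" "B \<in> S \<rightarrow> carrier W"
  shows "[:c:] \<odot> (\<Oplus>k\<in>S. B k) = (\<Oplus>k\<in>S. [:c:] \<odot> B k)"
  using assms
proof (induction S rule: finite_induct)
  case (insert k S)
  then have "B \<in> S \<rightarrow> carrier W" "B k \<in> carrier W" by auto
  with insert show ?case
    by (simp add: finsum_insert scale_r_distr Pi_def)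
qed simp

end

lemma complex_space_module:
  assumes "Module.module H_ring A"
  shows "complex_space A"
proof -
  interpret module H_ring A by fact
  have [simp]: "carrier H_ring = UNIV" "x \<otimes>\<^bsub>H_ring\<^esub> y = x * y" "x \<oplus>\<^bsub>H_ring\<^esub> y = x + y"
      "\<one>\<^bsub>H_ring\<^esub> = 1" for x y
    by (auto simp: ring_of_type_algebra_def)
  show ?thesis
  proof
    fix x c d assume x: "x \<in> carrier A"
    show "[:c:] \<odot>\<^bsub>A\<^esub> x \<in> carrier A" using x by simp
    show "[:c + d:] \<odot>\<^bsub>A\<^esub> x = [:c:] \<odot>\<^bsub>A\<^esub> x \<oplus>\<^bsub>A\<^esub> [:d:] \<odot>\<^bsub>A\<^esub> x"
      using smult_l_distr[of "[:c:]" "[:d:]" x] x by simp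
    show "[:c * d:] \<odot>\<^bsub>A\<^esub> x = [:c:] \<odot>\<^bsub>A\<^esub> ([:d:] \<odot>\<^bsub>A\<^esub> x)"
      using smult_assoc1[of "[:c:]" "[:d:]" x] x by (simp add: mult.commute)
    show "1 \<odot>\<^bsub>A\<^esub> x = x" using smult_one[of x] x by simp
    fix y assume "y \<in> carrier A"
    then show "[:c:] \<odot>\<^bsub>A\<^esub> (x \<oplus>\<^bsub>A\<^esub> y) = [:c:] \<odot>\<^bsub>A\<^esub> x \<oplus>\<^bsub>A\<^esub> [:c:] \<odot>\<^bsub>A\<^esub> y"
      using x by (simp add: smult_r_distr)
  qed
qed

definition complex_linear :: "'a hmodule \<Rightarrow> 'b hmodule \<Rightarrow> ('a \<Rightarrow> 'b) \<Rightarrow> bool" where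
  "complex_linear A B f \<longleftrightarrow> (\<forall>x\<in>carrier A. f x \<in> carrier B) \<and>
     (\<forall>x\<in>carrier A. \<forall>y\<in>carrier A. f (x \<oplus>\<^bsub>A\<^esub> y) = f x \<oplus>\<^bsub>B\<^esub> f y) \<and>
     (\<forall>c. \<forall>x\<in>carrier A. f ([:c:] \<odot>\<^bsub>A\<^esub> x) = [:c:] \<odot>\<^bsub>B\<^esub> f x)"

lemma complex_linearD:
  assumes "complex_linear A B f" "x \<in> carrier A"
  shows "f x \<in> carrier B"
    and "y \<in> carrier A \<Longrightarrow> f (x \<oplus>\<^bsub>A\<^esub> y) = f x \<oplus>\<^bsub>B\<^esub> f y"
    and "f ([:c:] \<odot>\<^bsub>A\<^esub> x) = [:c:] \<odot>\<^bsub>B\<^esub> f x"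
  using assms by (auto simp: complex_linear_def)

lemma complex_linear_id: "complex_linear A A (\<lambda>x. x)"
  by (simp add: complex_linear_def)

lemma complex_linear_comp:
  "complex_linear A B f \<Longrightarrow> complex_linear B C g \<Longrightarrow> complex_linear A C (\<lambda>x. g (f x))"
  by (simp add: complex_linear_def)

definition complex_bilinear ::
  "'a hmodule \<Rightarrow> 'b hmodule \<Rightarrow> 'w hmodule \<Rightarrow> ('a \<Rightarrow> 'b \<Rightarrow> 'w) \<Rightarrow> bool" where
  "complex_bilinear A B W \<beta> \<longleftrightarrow>
     (\<forall>b\<in>carrier B. complex_linear A W (\<lambda>a. \<beta> a b)) \<and>
     (\<forall>a\<in>carrier A. complex_linear B W (\<beta> a))"

locale two_spaces = A: complex_space A + B: complex_space B
  for A :: "'a hmodule" and B :: "'b hmodule"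
begin

lemma bilinear_rels_keys:
  "f \<in> bilinear_rels A B \<Longrightarrow> Poly_Mapping.keys f \<subseteq> carrier A \<times> carrier B"
proof (induction rule: bilinear_rels.induct)
  case (add f g)
  then show ?case using keys_add[of f g] by blast
next
  case (scale f c)
  then show ?case using keys_pm_scale[of c f] by blast
qed (auto simp: in_keys_iff lookup_minus lookup_single when_def split: if_splits)

end

lemma bilinear_rels_uminus: "f \<in> bilinear_rels A B \<Longrightarrow> - f \<in> bilinear_rels A B"
  using bilinear_rels.scale[of f A B "-1"] by (simp add: pm_scale_uminus_one)

lemma bilinear_rels_diff:
  "f \<in> bilinear_rels A B \<Longrightarrow> g \<in> bilinear_rels A B \<Longrightarrow> f - g \<in> bilinear_rels A B"
  using bilinear_rels.add[of f A B "- g"] by (simp add: bilinear_rels_uminus)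

lemma bilinear_rels_sum:
  "(\<And>i. i \<in> I \<Longrightarrow> F i \<in> bilinear_rels A B) \<Longrightarrow> (\<Sum>i\<in>I. F i) \<in> bilinear_rels A B"
  by (induction I rule: infinite_finite_induct) (auto intro: bilinear_rels.intros)

lemma mem_tensor_class: "g \<in> tensor_class A B f \<longleftrightarrow> g - f \<in> bilinear_rels A B"
  by (auto simp: tensor_class_def intro!: exI[of _ "g - f"])

lemma tensor_class_eq_iff: "tensor_class A B f = tensor_class A B g \<longleftrightarrow> f - g \<in> bilinear_rels A B"
proof
  assume "tensor_class A B f = tensor_class A B g"
  moreover have "f \<in> tensor_class A B f"
    by (simp add: mem_tensor_class bilinear_rels.zero)
  ultimately show "f - g \<in> bilinear_rels A B"
    by (simp add: mem_tensor_class)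
next
  assume fg: "f - g \<in> bilinear_rels A B"
  have "h - f \<in> bilinear_rels A B \<longleftrightarrow> h - g \<in> bilinear_rels A B" for h
    using bilinear_rels.add[OF _ fg, of "h - f"] bilinear_rels_diff[OF _ fg, of "h - g"] by auto
  then show "tensor_class A B f = tensor_class A B g"
    by (auto simp: mem_tensor_class)
qed

lemma tensor_class_self: "f \<in> tensor_class A B f"
  by (simp add: mem_tensor_class bilinear_rels.zero)


text \<open>The support is not additive, so for linearity the sum defining the linear extension is first taken
  over a common finite set containing the supports.\<close>

context complex_space
begin

lemma linear_extension_superset:
  assumes "finite S" "Poly_Mapping.keys f \<subseteq> S" "\<And>k. k \<in> S \<Longrightarrow> \<beta> (fst k) (snd k) \<in> carrier W"
  shows "linear_extension W \<beta> f =
     (\<Oplus>k\<in>S. [:Poly_Mapping.lookup f k:] \<odot> \<beta> (fst k) (snd k))"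
  unfolding linear_extension_def
  by (rule add.finprod_mono_neutral_cong_left) (use assms in \<open>auto simp: in_keys_iff\<close>)

lemma linear_extension_closed:
  assumes "\<And>k. k \<in> Poly_Mapping.keys f \<Longrightarrow> \<beta> (fst k) (snd k) \<in> carrier W"
  shows "linear_extension W \<beta> f \<in> carrier W"
  unfolding linear_extension_def by (rule finsum_closed) (use assms in auto)

lemma linear_extension_add:
  assumes "\<And>k. k \<in> K \<Longrightarrow> \<beta> (fst k) (snd k) \<in> carrier W"
    and "Poly_Mapping.keys f \<subseteq> K" "Poly_Mapping.keys g \<subseteq> K"
  shows "linear_extension W \<beta> (f + g) = linear_extension W \<beta> f \<oplus> linear_extension W \<beta> g"
proof -
  let ?S = "Poly_Mapping.keys f \<union> Poly_Mapping.keys g"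
  have S: "\<beta> (fst k) (snd k) \<in> carrier W" if "k \<in> ?S" for k
    using assms that by auto
  note s = linear_extension_superset[of ?S _ \<beta>, OF _ _ S]
  have "linear_extension W \<beta> (f + g) =
      (\<Oplus>k\<in>?S. [:Poly_Mapping.lookup f k:] \<odot> \<beta> (fst k) (snd k) \<oplus>
                 [:Poly_Mapping.lookup g k:] \<odot> \<beta> (fst k) (snd k))"
    unfolding s[of "f + g", OF _ keys_add, simplified]
    by (rule finsum_cong') (use S in \<open>auto simp: lookup_add scale_l_distr[symmetric]\<close>)
  also have "\<dots> = linear_extension W \<beta> f \<oplus> linear_extension W \<beta> g"
    using s[of f] s[of g] by (subst finsum_addf) (use S in auto)
  finally show ?thesis .
qed

lemma linear_extension_scale:
  assumes "\<And>k. k \<in> Poly_Mapping.keys f \<Longrightarrow> \<beta> (fst k) (snd k) \<in> carrier W"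
  shows "linear_extension W \<beta> (pm_scale c f) = [:c:] \<odot> linear_extension W \<beta> f"
proof -
  have "linear_extension W \<beta> (pm_scale c f) =
      (\<Oplus>k\<in>Poly_Mapping.keys f. [:c:] \<odot> ([:Poly_Mapping.lookup f k:] \<odot> \<beta> (fst k) (snd k)))"
    by (subst linear_extension_superset[of "Poly_Mapping.keys f"])
      (use assms keys_pm_scale[of c f] in \<open>auto simp: scale_assoc intro!: finsum_cong'\<close>)
  also have "\<dots> = [:c:] \<odot> linear_extension W \<beta> f"
    unfolding linear_extension_def by (rule finsum_scale[symmetric]) (use assms in auto)
  finally show ?thesis .
qed

lemma linear_extension_zero [simp]: "linear_extension W \<beta> 0 = \<zero>"
  by (simp add: linear_extension_def)

lemma linear_extension_basis [simp]:
  "\<beta> a b \<in> carrier W \<Longrightarrow> linear_extension W \<beta> (pm_basis (a, b)) = \<beta> a b"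
  using scale_one[of "\<beta> a b"] by (simp add: linear_extension_def finsum_insert one_pCons)

lemma linear_extension_diff:
  assumes "\<And>k. k \<in> K \<Longrightarrow> \<beta> (fst k) (snd k) \<in> carrier W"
    and "Poly_Mapping.keys f \<subseteq> K" "Poly_Mapping.keys g \<subseteq> K"
  shows "linear_extension W \<beta> (f - g) = linear_extension W \<beta> f \<ominus> linear_extension W \<beta> g"
proof -
  have "Poly_Mapping.keys (f - g) \<subseteq> K"
    using assms keys_diff[of f g] by blast
  then have "linear_extension W \<beta> f = linear_extension W \<beta> (f - g) \<oplus> linear_extension W \<beta> g"
    using linear_extension_add[of K \<beta> "f - g" g] assms by simp
  moreover have "linear_extension W \<beta> h \<in> carrier W" if "Poly_Mapping.keys h \<subseteq> K" for h
    by (rule linear_extension_closed) (use assms that in auto)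
  ultimately show ?thesis
    using \<open>Poly_Mapping.keys (f - g) \<subseteq> K\<close> assms
    by (simp add: minus_eq add.m_assoc r_neg)
qed

end

lemma coproduct_act_basis_const:
  assumes "complex_space A" "complex_space B" "k \<in> carrier A \<times> carrier B"
  shows "coproduct_act_basis A B [:c:] k = pm_scale c (pm_basis k)"
proof -
  interpret A: complex_space A by fact
  interpret B: complex_space B by fact
  have "divpow 0 = 1" by (simp add: divpow_def)
  then show ?thesis
    using assms(3) by (auto simp: coproduct_act_basis_def)
qed

context two_spaces
begin

abbreviation "AB \<equiv> tensor_module A B"

abbreviation supported :: "('a \<times> 'b \<Rightarrow>\<^sub>0 complex) \<Rightarrow> bool" where
  "supported f \<equiv> Poly_Mapping.keys f \<subseteq> carrier A \<times> carrier B"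

lemma supported_add: "supported f \<Longrightarrow> supported g \<Longrightarrow> supported (f + g)"
  using keys_add[of f g] by blast

lemma supported_diff: "supported f \<Longrightarrow> supported g \<Longrightarrow> supported (f - g)"
  using keys_diff[of f g] by blast

lemma supported_scale: "supported f \<Longrightarrow> supported (pm_scale c f)"
  using keys_pm_scale[of c f] by blast

lemma tensor_carrierE:
  assumes "u \<in> carrier AB"
  obtains f where "supported f" "u = tensor_class A B f"
  using assms by (auto simp: tensor_module_def)

lemma tensor_carrierI [intro]: "supported f \<Longrightarrow> tensor_class A B f \<in> carrier AB"
  by (auto simp: tensor_module_def)

lemma pure_closed [simp, intro]: "a \<in> carrier A \<Longrightarrow> b \<in> carrier B \<Longrightarrow> pure A B a b \<in> carrier AB"
  unfolding pure_def by (rule tensor_carrierI) simp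

lemma tensor_add: "tensor_class A B f \<oplus>\<^bsub>AB\<^esub> tensor_class A B g = tensor_class A B (f + g)"
proof (rule Set.set_eqI)
  fix h
  have "h \<in> tensor_class A B f \<oplus>\<^bsub>AB\<^esub> tensor_class A B g \<longleftrightarrow>
      (\<exists>f' g'. h = f' + g' \<and> f' - f \<in> bilinear_rels A B \<and> g' - g \<in> bilinear_rels A B)"
    by (auto simp: tensor_module_def mem_tensor_class)
  also have "\<dots> \<longleftrightarrow> h - (f + g) \<in> bilinear_rels A B"
  proof
    assume "\<exists>f' g'. h = f' + g' \<and> f' - f \<in> bilinear_rels A B \<and> g' - g \<in> bilinear_rels A B"
    then show "h - (f + g) \<in> bilinear_rels A B"
      using bilinear_rels.add[of _ A B] by (metis add_diff_add)
  next
    assume "h - (f + g) \<in> bilinear_rels A B"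
    then have "h = (h - g) + g \<and> h - g - f \<in> bilinear_rels A B \<and> g - g \<in> bilinear_rels A B"
      by (simp add: bilinear_rels.zero algebra_simps)
    then show "\<exists>f' g'. h = f' + g' \<and> f' - f \<in> bilinear_rels A B \<and> g' - g \<in> bilinear_rels A B"
      by blast
  qed
  finally show "h \<in> tensor_class A B f \<oplus>\<^bsub>AB\<^esub> tensor_class A B g \<longleftrightarrow> h \<in> tensor_class A B (f + g)"
    by (simp add: mem_tensor_class)
qed

lemma tensor_zero: "\<zero>\<^bsub>AB\<^esub> = tensor_class A B 0"
  by (simp add: tensor_module_def)

text \<open>If an operator on the free vector space preserves the relations, then the union over a coset
  in the definition of the action is the coset of any one image.\<close>

lemma tensor_smult:
  assumes "\<And>r. r \<in> bilinear_rels A B \<Longrightarrow> coproduct_act A B h r \<in> bilinear_rels A B"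
  shows "h \<odot>\<^bsub>AB\<^esub> tensor_class A B f = tensor_class A B (coproduct_act A B h f)"
proof -
  have "tensor_class A B (coproduct_act A B h g) = tensor_class A B (coproduct_act A B h f)"
    if "g \<in> tensor_class A B f" for g
    using assms[of "g - f"] that
    by (simp add: mem_tensor_class tensor_class_eq_iff coproduct_act_eq free_extension_diff)
  moreover have "tensor_class A B f \<noteq> {}"
    using tensor_class_self[of f A B] by blast
  ultimately have "(\<Union>g\<in>tensor_class A B f. tensor_class A B (coproduct_act A B h g)) =
      tensor_class A B (coproduct_act A B h f)"
    by (intro SUP_eq_const) auto
  then show ?thesis by (simp add: tensor_module_def)
qed

lemma coproduct_act_const:
  assumes "supported f"
  shows "coproduct_act A B [:c:] f = pm_scale c f"
proof -
  have "coproduct_act A B [:c:] f = (\<Sum>k\<in>Poly_Mapping.keys f.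
      pm_scale c (pm_scale (Poly_Mapping.lookup f k) (pm_basis k)))"
    unfolding coproduct_act_def
  proof (rule sum.cong)
    fix k assume "k \<in> Poly_Mapping.keys f"
    with assms have "k \<in> carrier A \<times> carrier B" by blast
    then show "pm_scale (Poly_Mapping.lookup f k) (coproduct_act_basis A B [:c:] k) =
        pm_scale c (pm_scale (Poly_Mapping.lookup f k) (pm_basis k))"
      by (simp only: coproduct_act_basis_const[OF A.complex_space_axioms B.complex_space_axioms]
          pm_scale_scale mult.commute)
  qed simp
  also have "\<dots> = pm_scale c f"
    using arg_cong[OF pm_basis_expansion[of f], of "pm_scale c"] by (simp only: pm_scale_sum)
  finally show ?thesis .
qed

lemma tensor_scale: "supported f \<Longrightarrow> [:c:] \<odot>\<^bsub>AB\<^esub> tensor_class A B f = tensor_class A B (pm_scale c f)"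
  by (subst tensor_smult)
    (simp_all add: coproduct_act_const bilinear_rels_keys bilinear_rels.scale)

lemma tensor_complex_space: "complex_space AB"
proof -
  have "abelian_group AB"
  proof (rule abelian_groupI)
    fix u assume u: "u \<in> carrier AB"
    then obtain f where f: "supported f" "u = tensor_class A B f" by (rule tensor_carrierE)
    have "supported (pm_scale (-1) f)" by (rule supported_scale) (rule f)
    moreover have "pm_scale (-1) f + f = 0" by (simp add: pm_scale_uminus_one)
    ultimately show "\<exists>v\<in>carrier AB. v \<oplus>\<^bsub>AB\<^esub> u = \<zero>\<^bsub>AB\<^esub>"
      using f by (auto simp: tensor_zero tensor_add intro!: bexI[of _ "tensor_class A B (pm_scale (-1) f)"])
    fix v assume v: "v \<in> carrier AB"
    then obtain g where g: "supported g" "v = tensor_class A B g" by (rule tensor_carrierE)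
    show "u \<oplus>\<^bsub>AB\<^esub> v \<in> carrier AB" using f g supported_add[of f g] by (auto simp: tensor_add)
    show "u \<oplus>\<^bsub>AB\<^esub> v = v \<oplus>\<^bsub>AB\<^esub> u" using f g by (simp add: tensor_add add.commute)
  qed (auto simp: tensor_zero tensor_add add.assoc elim!: tensor_carrierE)
  moreover have "complex_space_axioms AB"
  proof
    fix u c d assume "u \<in> carrier AB"
    then obtain f where f: "supported f" "u = tensor_class A B f" by (rule tensor_carrierE)
    note fs = supported_scale[OF f(1)]
    show "[:c:] \<odot>\<^bsub>AB\<^esub> u \<in> carrier AB" using f fs by (auto simp: tensor_scale)
    show "[:c + d:] \<odot>\<^bsub>AB\<^esub> u = [:c:] \<odot>\<^bsub>AB\<^esub> u \<oplus>\<^bsub>AB\<^esub> [:d:] \<odot>\<^bsub>AB\<^esub> u"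
      using f fs by (simp add: tensor_scale tensor_add pm_scale_add_left)
    show "[:c * d:] \<odot>\<^bsub>AB\<^esub> u = [:c:] \<odot>\<^bsub>AB\<^esub> ([:d:] \<odot>\<^bsub>AB\<^esub> u)"
      using f fs by (simp add: tensor_scale pm_scale_scale)
    show "1 \<odot>\<^bsub>AB\<^esub> u = u"
      using f tensor_scale[of f 1] by (simp add: one_pCons)
    fix v assume "v \<in> carrier AB"
    then obtain g where g: "supported g" "v = tensor_class A B g" by (rule tensor_carrierE)
    show "[:c:] \<odot>\<^bsub>AB\<^esub> (u \<oplus>\<^bsub>AB\<^esub> v) = [:c:] \<odot>\<^bsub>AB\<^esub> u \<oplus>\<^bsub>AB\<^esub> [:c:] \<odot>\<^bsub>AB\<^esub> v"
      using f g by (simp add: tensor_scale tensor_add supported_add pm_scale_add)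
  qed
  ultimately show ?thesis by (simp add: complex_space_def)
qed

lemma pure_bilinear: "complex_bilinear A B AB (pure A B)"
proof -
  have add: "pure A B (a \<oplus>\<^bsub>A\<^esub> a') b = pure A B a b \<oplus>\<^bsub>AB\<^esub> pure A B a' b"
    if "a \<in> carrier A" "a' \<in> carrier A" "b \<in> carrier B" for a a' b
    using bilinear_rels.add_left[OF that]
    by (simp add: pure_def tensor_add tensor_class_eq_iff diff_diff_eq)
  have scale: "pure A B ([:c:] \<odot>\<^bsub>A\<^esub> a) b = [:c:] \<odot>\<^bsub>AB\<^esub> pure A B a b"
    if "a \<in> carrier A" "b \<in> carrier B" for a b c
    using bilinear_rels.scale_left[OF that, of c] that
    by (simp add: pure_def tensor_scale tensor_class_eq_iff)
  have add': "pure A B a (b \<oplus>\<^bsub>B\<^esub> b') = pure A B a b \<oplus>\<^bsub>AB\<^esub> pure A B a b'"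
    if "a \<in> carrier A" "b \<in> carrier B" "b' \<in> carrier B" for a b b'
    using bilinear_rels.add_right[OF that]
    by (simp add: pure_def tensor_add tensor_class_eq_iff diff_diff_eq)
  have scale': "pure A B a ([:c:] \<odot>\<^bsub>B\<^esub> b) = [:c:] \<odot>\<^bsub>AB\<^esub> pure A B a b"
    if "a \<in> carrier A" "b \<in> carrier B" for a b c
    using bilinear_rels.scale_right[OF that, of c] that
    by (simp add: pure_def tensor_scale tensor_class_eq_iff)
  show ?thesis
    by (simp add: complex_bilinear_def complex_linear_def add scale add' scale')
qed

text \<open>Every element of the tensor product is the class of a finite linear combination of basis vectors,
  and the class of a basis vector is a pure tensor.\<close>

lemma tensor_linear_eq:
  assumes "complex_linear AB W f" "complex_linear AB W g" "complex_space W"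
    and eq: "\<And>a b. a \<in> carrier A \<Longrightarrow> b \<in> carrier B \<Longrightarrow> f (pure A B a b) = g (pure A B a b)"
    and u: "u \<in> carrier AB"
  shows "f u = g u"
proof -
  interpret W: complex_space W by fact
  note f = complex_linearD[OF assms(1)] and g = complex_linearD[OF assms(2)]
  obtain x where x: "supported x" "u = tensor_class A B x" using u by (rule tensor_carrierE)
  have "f (tensor_class A B x) = g (tensor_class A B x)"
    using x(1)
  proof (induction rule: free_induct)
    case zero
    have "tensor_class A B 0 = [:0:] \<odot>\<^bsub>AB\<^esub> tensor_class A B 0"
      by (subst tensor_scale) simp_all
    then show ?case
      using f(3)[of "tensor_class A B 0" 0] g(3)[of "tensor_class A B 0" 0]
        f(1)[of "tensor_class A B 0"] g(1)[of "tensor_class A B 0"] by (simp add: tensor_carrierI)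
  next
    case (add x y)
    then show ?case by (simp add: tensor_add[symmetric] tensor_carrierI f(2) g(2))
  next
    case (scale c x)
    then show ?case by (simp add: tensor_scale[symmetric] tensor_carrierI f(3) g(3))
  next
    case (basis k)
    then show ?case using eq[of "fst k" "snd k"] by (auto simp: pure_def)
  qed
  with x show ?thesis by simp
qed

end

text \<open>The universal property: a bilinear map kills the relations, so its linear extension is
  constant on cosets.\<close>

locale tensor_lifting = two_spaces A B + W: complex_space W
  for A :: "'a hmodule" and B :: "'b hmodule" and W :: "'w hmodule" +
  fixes \<beta> :: "'a \<Rightarrow> 'b \<Rightarrow> 'w"
  assumes bilinear: "complex_bilinear A B W \<beta>"
begin

lemma \<beta>_closed [simp]: "a \<in> carrier A \<Longrightarrow> b \<in> carrier B \<Longrightarrow> \<beta> a b \<in> carrier W"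
  using bilinear by (auto simp: complex_bilinear_def complex_linear_def)

lemma \<beta>_linear:
  assumes "a \<in> carrier A" "b \<in> carrier B"
  shows "a' \<in> carrier A \<Longrightarrow> \<beta> (a \<oplus>\<^bsub>A\<^esub> a') b = \<beta> a b \<oplus>\<^bsub>W\<^esub> \<beta> a' b"
    and "b' \<in> carrier B \<Longrightarrow> \<beta> a (b \<oplus>\<^bsub>B\<^esub> b') = \<beta> a b \<oplus>\<^bsub>W\<^esub> \<beta> a b'"
    and "\<beta> ([:c:] \<odot>\<^bsub>A\<^esub> a) b = [:c:] \<odot>\<^bsub>W\<^esub> \<beta> a b"
    and "\<beta> a ([:c:] \<odot>\<^bsub>B\<^esub> b) = [:c:] \<odot>\<^bsub>W\<^esub> \<beta> a b"
  using bilinear assms by (auto simp: complex_bilinear_def complex_linear_def)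

lemma \<beta>_closed': "k \<in> carrier A \<times> carrier B \<Longrightarrow> \<beta> (fst k) (snd k) \<in> carrier W"
  by auto

lemma ext_add: "supported f \<Longrightarrow> supported g \<Longrightarrow>
    linear_extension W \<beta> (f + g) = linear_extension W \<beta> f \<oplus>\<^bsub>W\<^esub> linear_extension W \<beta> g"
  by (rule W.linear_extension_add) (rule \<beta>_closed')

lemma ext_diff: "supported f \<Longrightarrow> supported g \<Longrightarrow>
    linear_extension W \<beta> (f - g) = linear_extension W \<beta> f \<ominus>\<^bsub>W\<^esub> linear_extension W \<beta> g"
  by (rule W.linear_extension_diff) (rule \<beta>_closed')

lemma ext_closed: "supported f \<Longrightarrow> linear_extension W \<beta> f \<in> carrier W"
  by (rule W.linear_extension_closed) auto

lemma ext_scale: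
  "supported f \<Longrightarrow> linear_extension W \<beta> (pm_scale c f) = [:c:] \<odot>\<^bsub>W\<^esub> linear_extension W \<beta> f"
  by (rule W.linear_extension_scale) auto

lemma ext_relation: "r \<in> bilinear_rels A B \<Longrightarrow> linear_extension W \<beta> r = \<zero>\<^bsub>W\<^esub>"
proof (induction rule: bilinear_rels.induct)
  case (add f g)
  then show ?case by (simp add: ext_add bilinear_rels_keys)
next
  case (scale f c)
  then show ?case by (simp add: ext_scale bilinear_rels_keys)
next
  case (add_left a a' b)
  then show ?case
    by (simp add: ext_diff supported_diff \<beta>_linear W.minus_eq W.minus_add W.a_ac W.r_neg W.r_neg1 W.r_neg2)
next
  case (add_right a b b')
  then show ?case
    by (simp add: ext_diff supported_diff \<beta>_linear W.minus_eq W.minus_add W.a_ac W.r_neg W.r_neg1 W.r_neg2)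
next
  case (scale_left a b c)
  then show ?case
    by (simp add: ext_diff supported_scale ext_scale \<beta>_linear W.minus_eq W.r_neg)
next
  case (scale_right a b c)
  then show ?case
    by (simp add: ext_diff supported_scale ext_scale \<beta>_linear W.minus_eq W.r_neg)
qed simp

lemma lift_class:
  assumes f: "supported f"
  shows "tensor_lift W \<beta> (tensor_class A B f) = linear_extension W \<beta> f"
proof -
  have "linear_extension W \<beta> g = linear_extension W \<beta> f" if g: "g \<in> tensor_class A B f" for g
  proof -
    have r: "g - f \<in> bilinear_rels A B" using g by (simp add: mem_tensor_class)
    have "linear_extension W \<beta> ((g - f) + f) = linear_extension W \<beta> (g - f) \<oplus>\<^bsub>W\<^esub> linear_extension W \<beta> f"
      by (rule ext_add) (use r f bilinear_rels_keys in auto)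
    then show ?thesis using r f by (simp add: ext_relation ext_closed)
  qed
  then have "linear_extension W \<beta> ` tensor_class A B f = {linear_extension W \<beta> f}"
    using tensor_class_self[of f A B] by blast
  then show ?thesis by (simp add: tensor_lift_def)
qed

lemma lift_pure [simp]:
  "a \<in> carrier A \<Longrightarrow> b \<in> carrier B \<Longrightarrow> tensor_lift W \<beta> (pure A B a b) = \<beta> a b"
  by (simp add: pure_def lift_class)

lemma lift_linear: "complex_linear AB W (tensor_lift W \<beta>)"
  unfolding complex_linear_def
  by (auto elim!: tensor_carrierE simp: tensor_add tensor_scale lift_class ext_closed ext_scale
      supported_scale supported_add ext_add)

end

lemma tensor_lift:
  assumes "complex_space A" "complex_space B" "complex_space W" "complex_bilinear A B W \<beta>"
  shows tensor_lift_linear: "complex_linear (tensor_module A B) W (tensor_lift W \<beta>)"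
    and tensor_lift_pure: "a \<in> carrier A \<Longrightarrow> b \<in> carrier B \<Longrightarrow> tensor_lift W \<beta> (pure A B a b) = \<beta> a b"
proof -
  interpret tensor_lifting A B W \<beta>
    using assms by (simp add: tensor_lifting_def two_spaces_def tensor_lifting_axioms_def)
  show "complex_linear (tensor_module A B) W (tensor_lift W \<beta>)"
    by (rule lift_linear)
  show "a \<in> carrier A \<Longrightarrow> b \<in> carrier B \<Longrightarrow> tensor_lift W \<beta> (pure A B a b) = \<beta> a b"
    by simp
qed

lemma (in complex_space) scale_linear: "complex_linear W W (\<lambda>x. [:c:] \<odot> x)"
  unfolding complex_linear_def
proof (intro conjI ballI allI)
  fix d x assume "x \<in> carrier W"
  then show "[:c:] \<odot> ([:d:] \<odot> x) = [:d:] \<odot> ([:c:] \<odot> x)"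
    using scale_assoc[of x c d] scale_assoc[of x d c] by (simp only: mult.commute)
qed (auto simp: scale_r_distr)

lemma (in complex_space) add_linear:
  assumes "complex_linear A W f" "complex_linear A W g"
  shows "complex_linear A W (\<lambda>x. f x \<oplus> g x)"
  unfolding complex_linear_def
  using complex_linearD[OF assms(1)] complex_linearD[OF assms(2)]
  by (auto simp: scale_r_distr a_ac)

lemma complex_bilinear_comp:
  assumes "complex_bilinear A' B' W \<beta>" "complex_linear A A' f" "complex_linear B B' g"
  shows "complex_bilinear A B W (\<lambda>a b. \<beta> (f a) (g b))"
  using assms by (simp add: complex_bilinear_def complex_linear_def)

lemma complex_bilinear_swap:
  "complex_bilinear A B W \<beta> \<Longrightarrow> complex_bilinear B A W (\<lambda>b a. \<beta> a b)"
  by (simp add: complex_bilinear_def complex_linear_def)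

lemma complex_bilinear_post:
  "complex_bilinear A B W \<beta> \<Longrightarrow> complex_linear W Z f \<Longrightarrow> complex_bilinear A B Z (\<lambda>a b. f (\<beta> a b))"
  by (simp add: complex_bilinear_def complex_linear_def)

lemma complex_bilinearI:
  assumes "\<And>b. b \<in> carrier B \<Longrightarrow> complex_linear A W (\<lambda>a. \<beta> a b)"
    and "\<And>a. a \<in> carrier A \<Longrightarrow> complex_linear B W (\<beta> a)"
  shows "complex_bilinear A B W \<beta>"
  using assms by (simp add: complex_bilinear_def)

lemma complex_bilinearD:
  assumes "complex_bilinear A B W \<beta>"
  shows "b \<in> carrier B \<Longrightarrow> complex_linear A W (\<lambda>a. \<beta> a b)"
    and "a \<in> carrier A \<Longrightarrow> complex_linear B W (\<beta> a)"
  using assms by (simp_all add: complex_bilinear_def)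

lemma tensor_space: "complex_space A \<Longrightarrow> complex_space B \<Longrightarrow> complex_space (tensor_module A B)"
  by (rule two_spaces.tensor_complex_space) (simp add: two_spaces_def)

lemma pure_bilin:
  "complex_space A \<Longrightarrow> complex_space B \<Longrightarrow> complex_bilinear A B (tensor_module A B) (pure A B)"
  by (rule two_spaces.pure_bilinear) (simp add: two_spaces_def)

lemma pure_in_tensor:
  "complex_space A \<Longrightarrow> complex_space B \<Longrightarrow> a \<in> carrier A \<Longrightarrow> b \<in> carrier B \<Longrightarrow>
   pure A B a b \<in> carrier (tensor_module A B)"
  by (rule two_spaces.pure_closed) (simp_all add: two_spaces_def)

lemma tensor_eqI:
  assumes "u \<in> carrier (tensor_module A B)"
    and "complex_space A" "complex_space B" "complex_space W"
    and "complex_linear (tensor_module A B) W f" "complex_linear (tensor_module A B) W g"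
    and "\<And>a b. a \<in> carrier A \<Longrightarrow> b \<in> carrier B \<Longrightarrow> f (pure A B a b) = g (pure A B a b)"
  shows "f u = g u"
  by (rule two_spaces.tensor_linear_eq[of A B W f g]) (use assms in \<open>auto simp: two_spaces_def\<close>)

lemma tensor_map:
  assumes "complex_space A" "complex_space B" "complex_space A'" "complex_space B'"
    and "complex_linear A A' f" "complex_linear B B' g"
  shows tensor_map_linear:
      "complex_linear (tensor_module A B) (tensor_module A' B') (tensor_map A' B' f g)"
    and tensor_map_pure: "a \<in> carrier A \<Longrightarrow> b \<in> carrier B \<Longrightarrow>
      tensor_map A' B' f g (pure A B a b) = pure A' B' (f a) (g b)"
  using tensor_lift[OF assms(1,2) tensor_space[OF assms(3,4)]
      complex_bilinear_comp[OF pure_bilin[OF assms(3,4)] assms(5,6)]]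
  by (auto simp: tensor_map_def)

lemma symmetry:
  assumes "complex_space A" "complex_space B"
  shows symmetry_linear: "complex_linear (tensor_module A B) (tensor_module B A) (symmetry A B)"
    and symmetry_pure: "a \<in> carrier A \<Longrightarrow> b \<in> carrier B \<Longrightarrow>
      symmetry A B (pure A B a b) = pure B A b a"
  using tensor_lift[OF assms tensor_space[OF assms(2,1)]
      complex_bilinear_swap[OF pure_bilin[OF assms(2,1)]]]
  by (auto simp: symmetry_def)

text \<open>The inner lift is linear in the first factor by construction. Its linearity in \<open>c\<close> holds on
  pure tensors, hence everywhere, because both sides of each equation are linear in the first factor.\<close>

lemma associator:
  assumes A: "complex_space A" and B: "complex_space B" and C: "complex_space C"
  shows associator_linear: "complex_linear (tensor_module (tensor_module A B) C)
      (tensor_module A (tensor_module B C)) (associator A B C)" (is ?lin)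
    and associator_pure: "a \<in> carrier A \<Longrightarrow> b \<in> carrier B \<Longrightarrow> c \<in> carrier C \<Longrightarrow>
      associator A B C (pure (tensor_module A B) C (pure A B a b) c) =
      pure A (tensor_module B C) a (pure B C b c)"
proof -
  let ?W = "tensor_module A (tensor_module B C)"
  let ?p = "\<lambda>c a b. pure A (tensor_module B C) a (pure B C b c)"
  let ?l = "\<lambda>u c. tensor_lift ?W (?p c) u"
  note BC = tensor_space[OF B C] and AB = tensor_space[OF A B]
  note W = tensor_space[OF A BC]
  interpret W: complex_space ?W by (rule W)
  have p: "complex_bilinear A B ?W (?p c)" if c: "c \<in> carrier C" for c
    by (rule complex_bilinear_comp[OF pure_bilin[OF A BC] complex_linear_id])
      (rule complex_bilinearD(1)[OF pure_bilin[OF B C] c])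
  note l = tensor_lift[OF A B W p]
  have pc: "complex_linear C ?W (\<lambda>c. ?p c a b)" if a: "a \<in> carrier A" and b: "b \<in> carrier B" for a b
    by (rule complex_linear_comp[OF complex_bilinearD(2)[OF pure_bilin[OF B C] b]
          complex_bilinearD(2)[OF pure_bilin[OF A BC] a]])
  interpret C: complex_space C by (rule C)
  have "complex_bilinear (tensor_module A B) C ?W ?l"
  proof (rule complex_bilinearI)
    show "complex_linear (tensor_module A B) ?W (\<lambda>u. ?l u c)" if "c \<in> carrier C" for c
      using l(1)[OF that] .
    show "complex_linear C ?W (?l u)" if u: "u \<in> carrier (tensor_module A B)" for u
      unfolding complex_linear_def
    proof (intro conjI ballI allI)
      fix c assume c: "c \<in> carrier C"
      note lc = complex_linearD[OF l(1)[OF c]]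
      show "?l u c \<in> carrier ?W" by (rule lc) (rule u)
      show "?l u ([:r:] \<odot>\<^bsub>C\<^esub> c) = [:r:] \<odot>\<^bsub>?W\<^esub> ?l u c" for r
      proof (rule tensor_eqI[OF u A B W])
        show "complex_linear (tensor_module A B) ?W (\<lambda>u. ?l u ([:r:] \<odot>\<^bsub>C\<^esub> c))"
          by (rule l(1)) (simp add: c)
        show "complex_linear (tensor_module A B) ?W (\<lambda>u. [:r:] \<odot>\<^bsub>?W\<^esub> ?l u c)"
          by (rule complex_linear_comp[OF l(1)[OF c] W.scale_linear])
        fix a b assume "a \<in> carrier A" "b \<in> carrier B"
        then show "?l (pure A B a b) ([:r:] \<odot>\<^bsub>C\<^esub> c) = [:r:] \<odot>\<^bsub>?W\<^esub> ?l (pure A B a b) c"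
          using l(2)[of "[:r:] \<odot>\<^bsub>C\<^esub> c" a b] l(2)[of c a b] complex_linearD(3)[OF pc c, of a b r] c
          by simp
      qed
      fix d assume d: "d \<in> carrier C"
      note ld = complex_linearD[OF l(1)[OF d]]
      show "?l u (c \<oplus>\<^bsub>C\<^esub> d) = ?l u c \<oplus>\<^bsub>?W\<^esub> ?l u d"
      proof (rule tensor_eqI[OF u A B W])
        show "complex_linear (tensor_module A B) ?W (\<lambda>u. ?l u (c \<oplus>\<^bsub>C\<^esub> d))"
          by (rule l(1)) (simp add: c d)
        show "complex_linear (tensor_module A B) ?W (\<lambda>u. ?l u c \<oplus>\<^bsub>?W\<^esub> ?l u d)"
          by (rule W.add_linear[OF l(1)[OF c] l(1)[OF d]])
        fix a b assume "a \<in> carrier A" "b \<in> carrier B"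
        then show "?l (pure A B a b) (c \<oplus>\<^bsub>C\<^esub> d) = ?l (pure A B a b) c \<oplus>\<^bsub>?W\<^esub> ?l (pure A B a b) d"
          using l(2)[of "c \<oplus>\<^bsub>C\<^esub> d" a b] l(2)[of c a b] l(2)[of d a b]
            complex_linearD(2)[OF pc c d, of a b] c d
          by simp
      qed
    qed
  qed
  note L = tensor_lift[OF AB C W this]
  show ?lin using L(1) by (simp add: associator_def)
  show "associator A B C (pure (tensor_module A B) C (pure A B a b) c) =
      pure A (tensor_module B C) a (pure B C b c)"
    if "a \<in> carrier A" "b \<in> carrier B" "c \<in> carrier C"
    using L(2)[OF pure_in_tensor[OF A B that(1,2)] that(3)] l(2)[OF that(3,1,2)]
    unfolding associator_def by (rule trans)
qed

section \<open>Modules over \<open>\<complex>[T]\<close>\<close>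

locale hmodule = Module.module H_ring A for A :: "'v hmodule" (structure)
begin

lemma H_ring_simps [simp]:
  "carrier H_ring = UNIV" "g \<otimes>\<^bsub>H_ring\<^esub> h = g * h" "g \<oplus>\<^bsub>H_ring\<^esub> h = g + h"
  "\<one>\<^bsub>H_ring\<^esub> = 1" "\<zero>\<^bsub>H_ring\<^esub> = 0"
  by (auto simp: ring_of_type_algebra_def)

sublocale complex_space A
  by (rule complex_space_module) (rule module_axioms)

lemma act_closed [simp, intro]: "x \<in> carrier A \<Longrightarrow> h \<odot> x \<in> carrier A"
  by simp

lemma act_add_left: "x \<in> carrier A \<Longrightarrow> (g + h) \<odot> x = g \<odot> x \<oplus> h \<odot> x"
  using smult_l_distr[of g h x] by simp

lemma act_add_right: "x \<in> carrier A \<Longrightarrow> y \<in> carrier A \<Longrightarrow> h \<odot> (x \<oplus> y) = h \<odot> x \<oplus> h \<odot> y"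
  using smult_r_distr[of h x y] by simp

lemma act_mult: "x \<in> carrier A \<Longrightarrow> (g * h) \<odot> x = g \<odot> (h \<odot> x)"
  using smult_assoc1[of g h x] by simp

lemma act_commute: "x \<in> carrier A \<Longrightarrow> g \<odot> (h \<odot> x) = h \<odot> (g \<odot> x)"
  by (simp add: act_mult[symmetric] mult.commute)

lemma act_linear: "complex_linear A A (\<lambda>x. h \<odot> x)"
  by (simp add: complex_linear_def act_add_right act_commute[of _ h])

lemma act_sum: "finite I \<Longrightarrow> x \<in> carrier A \<Longrightarrow> (\<Sum>i\<in>I. h i) \<odot> x = (\<Oplus>i\<in>I. h i \<odot> x)"
  by (induction I rule: finite_induct) (auto simp: finsum_insert act_add_left)

lemma act_finsum:
  "finite I \<Longrightarrow> x \<in> I \<rightarrow> carrier A \<Longrightarrow> h \<odot> (\<Oplus>i\<in>I. x i) = (\<Oplus>i\<in>I. h \<odot> x i)"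
proof (induction I rule: finite_induct)
  case empty
  show ?case using smult_r_null[of h] by simp
next
  case (insert k I)
  then have "x \<in> I \<rightarrow> carrier A" "x k \<in> carrier A" by auto
  with insert show ?case by (simp add: finsum_insert act_add_right Pi_def)
qed

lemma act_pCons: "x \<in> carrier A \<Longrightarrow> pCons c h \<odot> x = [:c:] \<odot> x \<oplus> [:0, 1:] \<odot> (h \<odot> x)"
  by (simp add: act_add_left[symmetric] act_mult[symmetric])

end

lemma (in complex_space) scale_cancel:
  assumes "[:c:] \<odot> x = [:c:] \<odot> y" "c \<noteq> 0" "x \<in> carrier W" "y \<in> carrier W"
  shows "x = y"
proof -
  have "[:inverse c * c:] \<odot> x = [:inverse c * c:] \<odot> y"
    by (simp only: scale_assoc assms)
  then show ?thesis
    using assms scale_one by (simp add: one_pCons)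
qed

lemma divpow_0 [simp]: "divpow 0 = 1"
  by (simp add: divpow_def)

lemma divpow_Suc: "[:0, 1:] * divpow n = [:of_nat (Suc n):] * divpow (Suc n)"
  by (simp add: divpow_def smult_monom monom_Suc[symmetric] field_simps del: of_nat_Suc)

lemma divpow_monom: "[:fact i * c:] * divpow i = monom c i"
  by (simp add: divpow_def smult_monom)


section \<open>The action of the coproduct\<close>

definition coproduct_sum :: "complex poly \<Rightarrow> (nat \<Rightarrow> nat \<Rightarrow> ('k \<Rightarrow>\<^sub>0 complex)) \<Rightarrow> ('k \<Rightarrow>\<^sub>0 complex)" where
  "coproduct_sum h F =
     (\<Sum>i\<le>Polynomial.degree h. pm_scale (fact i * coeff h i) (\<Sum>p\<le>i. F p (i - p)))"

lemma coproduct_act_basis_eq: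
  "coproduct_act_basis A B h (a, b) =
     coproduct_sum h (\<lambda>p q. pm_basis (divpow p \<odot>\<^bsub>A\<^esub> a, divpow q \<odot>\<^bsub>B\<^esub> b))"
  by (simp add: coproduct_act_basis_def coproduct_sum_def)

lemma coproduct_sum_diff: "coproduct_sum h F - coproduct_sum h G = coproduct_sum h (\<lambda>p q. F p q - G p q)"
  by (simp add: coproduct_sum_def sum_subtractf pm_scale_diff)

lemma coproduct_sum_scale: "pm_scale c (coproduct_sum h F) = coproduct_sum h (\<lambda>p q. pm_scale c (F p q))"
  by (simp add: coproduct_sum_def pm_scale_sum pm_scale_scale mult.commute)

lemma coproduct_sum_rels:
  "(\<And>p q. F p q \<in> bilinear_rels A B) \<Longrightarrow> coproduct_sum h F \<in> bilinear_rels A B"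
  unfolding coproduct_sum_def by (intro bilinear_rels_sum bilinear_rels.scale)

locale two_hmodules = A: hmodule A + B: hmodule B
  for A :: "'a hmodule" and B :: "'b hmodule"
begin

sublocale two_spaces A B ..

text \<open>The coproduct consists of products of linear operators, so it maps each bilinearity relation
  to a sum of such relations.\<close>

lemma coproduct_act_rels:
  "r \<in> bilinear_rels A B \<Longrightarrow> coproduct_act A B h r \<in> bilinear_rels A B"
  unfolding coproduct_act_eq
proof (induction rule: bilinear_rels.induct)
  case (add f g)
  then show ?case by (simp add: free_extension_add bilinear_rels.add)
next
  case (scale f c)
  then show ?case by (simp add: free_extension_scale bilinear_rels.scale)
next
  case (add_left a a' b)
  then show ?case
    by (simp add: free_extension_diff coproduct_act_basis_eq coproduct_sum_diff A.act_add_right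
        coproduct_sum_rels bilinear_rels.add_left)
next
  case (add_right a b b')
  then show ?case
    by (simp add: free_extension_diff coproduct_act_basis_eq coproduct_sum_diff B.act_add_right
        coproduct_sum_rels bilinear_rels.add_right)
next
  case (scale_left a b c)
  then show ?case
    by (simp add: free_extension_diff free_extension_scale coproduct_act_basis_eq coproduct_sum_diff
        coproduct_sum_scale A.act_commute[of a _ "[:c:]"] coproduct_sum_rels bilinear_rels.scale_left)
next
  case (scale_right a b c)
  then show ?case
    by (simp add: free_extension_diff free_extension_scale coproduct_act_basis_eq coproduct_sum_diff
        coproduct_sum_scale B.act_commute[of b _ "[:c:]"] coproduct_sum_rels bilinear_rels.scale_right)
qed (simp add: bilinear_rels.zero)

lemma tensor_act: "h \<odot>\<^bsub>AB\<^esub> tensor_class A B f = tensor_class A B (coproduct_act A B h f)"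
  by (rule tensor_smult) (rule coproduct_act_rels)

lemma supported_sum: "(\<And>i. i \<in> I \<Longrightarrow> supported (F i)) \<Longrightarrow> supported (\<Sum>i\<in>I. F i)"
  by (induction I rule: infinite_finite_induct) (simp_all add: supported_add)

lemma supported_coproduct_act_basis:
  assumes "k \<in> carrier A \<times> carrier B"
  shows "supported (coproduct_act_basis A B h k)"
  unfolding coproduct_act_basis_def
  by (intro supported_sum supported_scale) (use assms in auto)

lemma supported_coproduct_act: "supported f \<Longrightarrow> supported (coproduct_act A B h f)"
  unfolding coproduct_act_def
  by (intro supported_sum supported_scale supported_coproduct_act_basis) auto

lemma tensor_act_closed: "u \<in> carrier AB \<Longrightarrow> h \<odot>\<^bsub>AB\<^esub> u \<in> carrier AB"
  by (erule tensor_carrierE) (simp add: tensor_act tensor_carrierI supported_coproduct_act)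

text \<open>For \<open>h = T\<close> the coproduct is \<open>T \<otimes> 1 + 1 \<otimes> T\<close>.\<close>

lemma T_pure:
  assumes "a \<in> carrier A" "b \<in> carrier B"
  shows "[:0, 1:] \<odot>\<^bsub>AB\<^esub> pure A B a b =
     pure A B ([:0, 1:] \<odot>\<^bsub>A\<^esub> a) b \<oplus>\<^bsub>AB\<^esub> pure A B a ([:0, 1:] \<odot>\<^bsub>B\<^esub> b)"
proof -
  have "divpow (Suc 0) = [:0, 1:]" by (simp add: divpow_def monom_Suc)
  then show ?thesis
    using assms
    by (simp add: pure_def tensor_act tensor_add coproduct_act_eq coproduct_act_basis_eq
        coproduct_sum_def add.commute)
qed

end

context tensor_lifting
begin

lemma ext_sum:
  assumes "finite I" "\<And>i. i \<in> I \<Longrightarrow> supported (F i)"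
  shows "supported (\<Sum>i\<in>I. F i) \<and>
    linear_extension W \<beta> (\<Sum>i\<in>I. F i) = (\<Oplus>\<^bsub>W\<^esub>i\<in>I. linear_extension W \<beta> (F i))"
  using assms
proof (induction I rule: finite_induct)
  case (insert i I)
  then show ?case
    by (simp add: W.finsum_insert ext_add ext_closed Pi_def supported_add)
qed simp

end


section \<open>Commutative differential algebras\<close>

text \<open>An invariant commutative algebra in terms of elements: a commutative complex algebra
  with a derivation, the derivation being the action of \<open>T = [:0, 1:]\<close>.\<close>

locale comm_diff_algebra = hmodule A for A :: "'v hmodule" (structure) +
  fixes m :: "'v \<Rightarrow> 'v \<Rightarrow> 'v" (infixl \<open>\<cdot>\<close> 70) and e :: 'v
  assumes m_closed [simp, intro]: "a \<in> carrier A \<Longrightarrow> b \<in> carrier A \<Longrightarrow> a \<cdot> b \<in> carrier A"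
    and m_add_left: "a \<in> carrier A \<Longrightarrow> a' \<in> carrier A \<Longrightarrow> b \<in> carrier A \<Longrightarrow>
      (a \<oplus> a') \<cdot> b = a \<cdot> b \<oplus> a' \<cdot> b"
    and m_scale_left: "a \<in> carrier A \<Longrightarrow> b \<in> carrier A \<Longrightarrow> ([:c:] \<odot> a) \<cdot> b = [:c:] \<odot> (a \<cdot> b)"
    and m_comm: "a \<in> carrier A \<Longrightarrow> b \<in> carrier A \<Longrightarrow> a \<cdot> b = b \<cdot> a"
    and m_assoc: "a \<in> carrier A \<Longrightarrow> b \<in> carrier A \<Longrightarrow> d \<in> carrier A \<Longrightarrow> (a \<cdot> b) \<cdot> d = a \<cdot> (b \<cdot> d)"
    and e_closed [simp, intro]: "e \<in> carrier A"
    and e_left: "a \<in> carrier A \<Longrightarrow> e \<cdot> a = a"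
    and T_derivation: "a \<in> carrier A \<Longrightarrow> b \<in> carrier A \<Longrightarrow>
      [:0, 1:] \<odot> (a \<cdot> b) = ([:0, 1:] \<odot> a) \<cdot> b \<oplus> a \<cdot> ([:0, 1:] \<odot> b)"
begin

lemma m_bilinear: "complex_bilinear A A A (\<cdot>)"
proof -
  have "complex_linear A A (\<lambda>a. a \<cdot> b)" if "b \<in> carrier A" for b
    using that by (simp add: complex_linear_def m_add_left m_scale_left)
  moreover have "complex_linear A A ((\<cdot>) a)" if "a \<in> carrier A" for a
    unfolding complex_linear_def
  proof (intro conjI ballI allI)
    fix x c assume x: "x \<in> carrier A"
    then show "a \<cdot> x \<in> carrier A" using that by simp
    show "a \<cdot> ([:c:] \<odot> x) = [:c:] \<odot> (a \<cdot> x)"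
      using m_comm[OF that x] m_comm[OF that, of "[:c:] \<odot> x"] that x by (simp add: m_scale_left)
    fix y assume y: "y \<in> carrier A"
    show "a \<cdot> (x \<oplus> y) = a \<cdot> x \<oplus> a \<cdot> y"
      using m_comm[OF that x] m_comm[OF that y] m_comm[OF that, of "x \<oplus> y"] that x y
      by (simp add: m_add_left)
  qed
  ultimately show ?thesis by (rule complex_bilinearI)
qed

lemmas m_scale_right = complex_linearD(3)[OF complex_bilinearD(2)[OF m_bilinear]]
lemmas m_add_right = complex_linearD(2)[OF complex_bilinearD(2)[OF m_bilinear]]

sublocale two_hmodules A A ..

sublocale tensor_lifting A A A "(\<cdot>)"
  by unfold_locales (rule m_bilinear)

lemma T_e: "[:0, 1:] \<odot> e = \<zero>"
proof -
  have "[:0, 1:] \<odot> e = [:0, 1:] \<odot> e \<oplus> [:0, 1:] \<odot> e"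
    using T_derivation[of e e] m_comm[of "[:0, 1:] \<odot> e" e] by (simp add: e_left)
  then show ?thesis
    using add.r_cancel_one'[of "[:0, 1:] \<odot> e" "[:0, 1:] \<odot> e"] by simp
qed

lemma act_e: "h \<odot> e = [:counit h:] \<odot> e"
proof (induction h)
  case (pCons c h)
  have "[:0, 1:] \<odot> ([:counit h:] \<odot> e) = \<zero>"
    by (subst act_commute) (simp_all add: T_e)
  then show ?case
    by (subst act_pCons) (simp_all add: pCons.IH counit_def)
qed (simp add: counit_def)

text \<open>With \<open>G p q = (D\<^sup>(\<^sup>p\<^sup>) a) (D\<^sup>(\<^sup>q\<^sup>) b)\<close>, the derivation \<open>T\<close> maps \<open>G p q\<close> to
  \<open>(p + 1) G (p + 1) q + (q + 1) G p (q + 1)\<close>. Summing over \<open>p + q = n\<close>, each \<open>G p q\<close> with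
  \<open>p + q = n + 1\<close> is counted \<open>p + q\<close> times, so that the induction step follows on division by \<open>n + 1\<close>.\<close>

lemma divpow_leibniz:
  assumes a: "a \<in> carrier A" and b: "b \<in> carrier A"
  shows "divpow n \<odot> (a \<cdot> b) = (\<Oplus>p\<in>{..n}. (divpow p \<odot> a) \<cdot> (divpow (n - p) \<odot> b))"
proof (induction n)
  case 0
  then show ?case using a b by simp
next
  case (Suc n)
  let ?G = "\<lambda>p q. (divpow p \<odot> a) \<cdot> (divpow q \<odot> b)"
  let ?N = "\<lambda>k::nat. [:of_nat k:] :: complex poly"
  have G: "?G p q \<in> carrier A" for p q using a b by simp
  have NG: "?N k \<odot> ?G p q \<in> carrier A" for k p q using a b by simp
  have T: "[:0, 1:] \<odot> (divpow k \<odot> x) = ?N (Suc k) \<odot> (divpow (Suc k) \<odot> x)" if "x \<in> carrier A" for x k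
    using that by (simp only: act_mult[symmetric] divpow_Suc)
  have "?N (Suc n) \<odot> (divpow (Suc n) \<odot> (a \<cdot> b)) = [:0, 1:] \<odot> (divpow n \<odot> (a \<cdot> b))"
    using T[of "a \<cdot> b" n] a b by simp
  also have "\<dots> = (\<Oplus>p\<in>{..n}. [:0, 1:] \<odot> ?G p (n - p))"
    unfolding Suc.IH by (rule act_finsum) (use G in auto)
  also have "\<dots> = (\<Oplus>p\<in>{..n}. ?N (Suc p) \<odot> ?G (Suc p) (n - p) \<oplus> ?N (Suc n - p) \<odot> ?G p (Suc n - p))"
  proof (rule finsum_cong')
    fix p assume "p \<in> {..n}"
    then have p: "Suc (n - p) = Suc n - p" by simp
    have "[:0, 1:] \<odot> ?G p (n - p) =
        ([:0, 1:] \<odot> (divpow p \<odot> a)) \<cdot> (divpow (n - p) \<odot> b) \<oplus>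
        (divpow p \<odot> a) \<cdot> ([:0, 1:] \<odot> (divpow (n - p) \<odot> b))"
      by (rule T_derivation) (use a b in auto)
    also have "\<dots> = ?N (Suc p) \<odot> ?G (Suc p) (n - p) \<oplus> ?N (Suc n - p) \<odot> ?G p (Suc n - p)"
      using a b by (simp only: T p m_scale_left m_scale_right act_closed)
    finally show "[:0, 1:] \<odot> ?G p (n - p) =
      ?N (Suc p) \<odot> ?G (Suc p) (n - p) \<oplus> ?N (Suc n - p) \<odot> ?G p (Suc n - p)" .
  qed (rule refl, intro Pi_I a_closed NG)
  also have "\<dots> = (\<Oplus>p\<in>{..n}. ?N (Suc p) \<odot> ?G (Suc p) (n - p)) \<oplus>
      (\<Oplus>p\<in>{..n}. ?N (Suc n - p) \<odot> ?G p (Suc n - p))"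
    by (rule finsum_addf) (intro Pi_I NG)+
  also have "(\<Oplus>p\<in>{..n}. ?N (Suc p) \<odot> ?G (Suc p) (n - p)) =
      (\<Oplus>p\<in>{..Suc n}. ?N p \<odot> ?G p (Suc n - p))"
    using finsum_Suc2[of "\<lambda>p. ?N p \<odot> ?G p (Suc n - p)" n] NG a b
    by (simp add: Pi_def finsum_closed del: of_nat_Suc finsum_Suc)
  also have "(\<Oplus>p\<in>{..n}. ?N (Suc n - p) \<odot> ?G p (Suc n - p)) =
      (\<Oplus>p\<in>{..Suc n}. ?N (Suc n - p) \<odot> ?G p (Suc n - p))"
    using finsum_Suc[of "\<lambda>p. ?N (Suc n - p) \<odot> ?G p (Suc n - p)" n] NG a b
    by (simp add: Pi_def finsum_closed del: of_nat_Suc)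
  also have "(\<Oplus>p\<in>{..Suc n}. ?N p \<odot> ?G p (Suc n - p)) \<oplus>
      (\<Oplus>p\<in>{..Suc n}. ?N (Suc n - p) \<odot> ?G p (Suc n - p)) =
      (\<Oplus>p\<in>{..Suc n}. ?N p \<odot> ?G p (Suc n - p) \<oplus> ?N (Suc n - p) \<odot> ?G p (Suc n - p))"
    by (rule finsum_addf[symmetric]) (intro Pi_I NG)+
  also have "\<dots> = (\<Oplus>p\<in>{..Suc n}. ?N (Suc n) \<odot> ?G p (Suc n - p))"
  proof (rule finsum_cong')
    fix p assume "p \<in> {..Suc n}"
    then have "of_nat p + of_nat (Suc n - p) = (of_nat (Suc n) :: complex)"
      by (simp only: of_nat_add[symmetric]) simp
    then show "?N p \<odot> ?G p (Suc n - p) \<oplus> ?N (Suc n - p) \<odot> ?G p (Suc n - p) =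
        ?N (Suc n) \<odot> ?G p (Suc n - p)"
      using scale_l_distr[OF G, of "of_nat p" "of_nat (Suc n - p)" p "Suc n - p"] by (simp only:)
  qed (rule refl, intro Pi_I NG)
  also have "\<dots> = ?N (Suc n) \<odot> (\<Oplus>p\<in>{..Suc n}. ?G p (Suc n - p))"
    by (rule finsum_scale[symmetric]) (use G in auto)
  finally show ?case
    by (rule scale_cancel) (use a b G in \<open>auto simp del: of_nat_Suc intro!: finsum_closed\<close>)
qed

text \<open>Both sides are additive in \<open>h\<close>, and for a monomial this is the Leibniz rule.\<close>

lemma act_m:
  assumes a: "a \<in> carrier A" and b: "b \<in> carrier A"
  shows "h \<odot> (a \<cdot> b) = linear_extension A (\<cdot>) (coproduct_act_basis A A h (a, b))"
proof -
  let ?B = "\<lambda>p q. pm_basis (divpow p \<odot> a, divpow q \<odot> b)"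
  let ?c = "\<lambda>i. fact i * Polynomial.coeff h i"
  have "linear_extension A (\<cdot>) (coproduct_act_basis A A h (a, b)) =
      (\<Oplus>i\<in>{..Polynomial.degree h}. linear_extension A (\<cdot>) (pm_scale (?c i) (\<Sum>p\<le>i. ?B p (i - p))))"
    unfolding coproduct_act_basis_eq coproduct_sum_def
    by (rule conjunct2[OF ext_sum]) (use a b in \<open>auto intro!: supported_scale supported_sum\<close>)
  also have "\<dots> = (\<Oplus>i\<in>{..Polynomial.degree h}. Polynomial.monom (Polynomial.coeff h i) i \<odot> (a \<cdot> b))"
  proof (rule finsum_cong')
    fix i
    have s: "supported (\<Sum>p\<le>i. ?B p (i - p))"
      by (rule supported_sum) (use a b in auto)
    have "linear_extension A (\<cdot>) (\<Sum>p\<le>i. ?B p (i - p)) =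
        (\<Oplus>p\<in>{..i}. linear_extension A (\<cdot>) (?B p (i - p)))"
      by (rule conjunct2[OF ext_sum]) (use a b in auto)
    also have "\<dots> = divpow i \<odot> (a \<cdot> b)"
      unfolding divpow_leibniz[OF a b] by (rule finsum_cong') (use a b in auto)
    finally have "linear_extension A (\<cdot>) (pm_scale (?c i) (\<Sum>p\<le>i. ?B p (i - p))) =
        [:?c i:] \<odot> (divpow i \<odot> (a \<cdot> b))"
      by (simp only: ext_scale[OF s])
    then show "linear_extension A (\<cdot>) (pm_scale (?c i) (\<Sum>p\<le>i. ?B p (i - p))) =
        Polynomial.monom (Polynomial.coeff h i) i \<odot> (a \<cdot> b)"
      using a b by (simp only: act_mult[symmetric] divpow_monom m_closed)
  qed (use a b in auto)
  also have "\<dots> = h \<odot> (a \<cdot> b)"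
    using a b by (simp add: act_sum[symmetric] poly_as_sum_of_monoms)
  finally show ?thesis by simp
qed

end

section \<open>Invariant commutative algebras and commutative differential algebras\<close>

lemma lin_hom_complex_linear: "f \<in> lin_hom H_ring M N \<Longrightarrow> complex_linear M N f"
  by (auto simp: lin_hom_def complex_linear_def ring_of_type_algebra_def)

lemma unit_module_space: "complex_space unit_module"
proof -
  have "abelian_group unit_module"
  proof (rule abelian_groupI)
    fix x assume "x \<in> carrier unit_module"
    show "\<exists>y\<in>carrier unit_module. y \<oplus>\<^bsub>unit_module\<^esub> x = \<zero>\<^bsub>unit_module\<^esub>"
      by (rule bexI[of _ "- x"]) (simp_all add: unit_module_def)
  qed (auto simp: unit_module_def)
  moreover have "complex_space_axioms unit_module"
    by unfold_locales (auto simp: unit_module_def counit_def algebra_simps)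
  ultimately show ?thesis by (simp add: complex_space_def)
qed

lemma unit_module_simps [simp]:
  "carrier unit_module = UNIV" "x \<oplus>\<^bsub>unit_module\<^esub> y = x + y" "h \<odot>\<^bsub>unit_module\<^esub> x = counit h * x"
  by (simp_all add: unit_module_def)

lemma (in complex_space) scalar_bilinear: "complex_bilinear unit_module W W (\<lambda>z a. [:z:] \<odot> a)"
proof (rule complex_bilinearI)
  show "complex_linear unit_module W (\<lambda>z. [:z:] \<odot> a)" if "a \<in> carrier W" for a
    using that by (simp add: complex_linear_def scale_l_distr scale_assoc counit_def)
qed (rule scale_linear)

lemma complex_linear_cong:
  assumes "complex_linear A B f" "complex_space A" "\<And>x. x \<in> carrier A \<Longrightarrow> g x = f x"
  shows "complex_linear A B g"
proof -
  interpret A: complex_space A by fact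
  show ?thesis using assms by (simp add: complex_linear_def)
qed

definition halgebra_of :: "'v hmodule \<Rightarrow> ('v \<Rightarrow> 'v \<Rightarrow> 'v) \<Rightarrow> 'v \<Rightarrow> 'v halgebra" where
  "halgebra_of A m e = \<lparr>hmod = A, hmult = restrict (tensor_lift A m) (carrier (tensor_module A A)),
     hunit = (\<lambda>z. [:z:] \<odot>\<^bsub>A\<^esub> e)\<rparr>"

definition hprod :: "'v halgebra \<Rightarrow> 'v \<Rightarrow> 'v \<Rightarrow> 'v" where
  "hprod \<A> a b = hmult \<A> (pure (hmod \<A>) (hmod \<A>) a b)"

context comm_diff_algebra
begin

abbreviation "\<mu> \<equiv> restrict (tensor_lift A (\<cdot>)) (carrier AB)"
abbreviation "\<eta> \<equiv> \<lambda>z. [:z:] \<odot> e"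

lemma \<mu>_linear: "complex_linear AB A \<mu>"
  by (rule complex_linear_cong[OF lift_linear tensor_complex_space]) simp

lemma \<eta>_linear: "complex_linear unit_module A \<eta>"
  by (simp add: complex_linear_def scale_l_distr[symmetric] scale_assoc[symmetric] counit_def)

text \<open>The linear extension of the product intertwines the coproduct action on the free vector space with the
  action on \<open>A\<close>: both are linear, so this reduces to basis vectors.\<close>

lemma lift_invariant:
  assumes "u \<in> carrier AB"
  shows "tensor_lift A (\<cdot>) (h \<odot>\<^bsub>AB\<^esub> u) = h \<odot> tensor_lift A (\<cdot>) u"
proof -
  obtain f where f: "supported f" "u = tensor_class A A f"
    using assms by (rule tensor_carrierE)
  from f(1) have "supported (coproduct_act A A h f) \<and>
      linear_extension A (\<cdot>) (coproduct_act A A h f) = h \<odot> linear_extension A (\<cdot>) f"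
    unfolding coproduct_act_eq
  proof (induction rule: free_induct)
    case zero
    show ?case using smult_r_null[of h] by simp
  next
    case (add f g)
    then show ?case
      by (simp add: free_extension_add ext_add supported_add act_add_right ext_closed)
  next
    case (scale c f)
    then show ?case
      by (simp add: free_extension_scale ext_scale supported_scale act_commute[of _ h] ext_closed)
  next
    case (basis k)
    then show ?case
      using act_m[of "fst k" "snd k" h] supported_coproduct_act_basis[of k h] by auto
  qed
  with f show ?thesis by (simp add: tensor_act lift_class)
qed

lemma comm_halgebra_halgebra_of: "comm_halgebra (halgebra_of A (\<cdot>) e)"
proof -
  let ?I = unit_module
  note A = complex_space_axioms
  note AA = tensor_complex_space and I = unit_module_space
  interpret AA: complex_space AB by (rule AA)
  note id = complex_linear_id[of A]
  have \<mu>_hom: "\<mu> \<in> lin_hom H_ring AB A"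
    using complex_linearD[OF \<mu>_linear]
    by (auto simp: lin_hom_def lift_invariant tensor_act_closed complex_linearD[OF lift_linear])
  have "[:counit h * z:] \<odot> e = h \<odot> ([:z:] \<odot> e)" for h z
    using act_commute[of e h "[:z:]"] act_e[of h] scale_assoc[of e z "counit h"]
    by (simp add: mult.commute)
  then have \<eta>_hom: "\<eta> \<in> lin_hom H_ring ?I A"
    by (auto simp: lin_hom_def scale_l_distr)
  have sym: "\<mu> (symmetry A A u) = \<mu> u" if u: "u \<in> carrier AB" for u
    by (rule tensor_eqI[OF u A A A complex_linear_comp[OF symmetry_linear[OF A A] \<mu>_linear] \<mu>_linear])
      (simp add: symmetry_pure[OF A A] m_comm)
  have assoc: "\<mu> (tensor_map A A \<mu> (\<lambda>a. a) u) = \<mu> (tensor_map A A (\<lambda>a. a) \<mu> (associator A A A u))"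
    if u: "u \<in> carrier (tensor_module AB A)" for u
  proof -
    note l = complex_linear_comp[OF tensor_map_linear[OF AA A A A \<mu>_linear id] \<mu>_linear]
    note r = complex_linear_comp[OF complex_linear_comp[OF associator_linear[OF A A A]
          tensor_map_linear[OF A AA A A id \<mu>_linear]] \<mu>_linear]
    note b = pure_bilin[OF AA A]
    show ?thesis
    proof (rule tensor_eqI[OF u AA A A l r])
      fix v d assume v: "v \<in> carrier AB" and d: "d \<in> carrier A"
      note p = complex_bilinearD(1)[OF b d]
      show "\<mu> (tensor_map A A \<mu> (\<lambda>a. a) (pure AB A v d)) =
          \<mu> (tensor_map A A (\<lambda>a. a) \<mu> (associator A A A (pure AB A v d)))"
      proof (rule tensor_eqI[OF v A A A complex_linear_comp[OF p l] complex_linear_comp[OF p r]])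
        fix x y assume x: "x \<in> carrier A" and y: "y \<in> carrier A"
        have "\<mu> (tensor_map A A \<mu> (\<lambda>a. a) (pure AB A (pure A A x y) d)) = (x \<cdot> y) \<cdot> d"
          by (subst tensor_map_pure[OF AA A A A \<mu>_linear id]) (use x y d in auto)
        moreover have "\<mu> (tensor_map A A (\<lambda>a. a) \<mu> (associator A A A (pure AB A (pure A A x y) d))) =
            x \<cdot> (y \<cdot> d)"
          unfolding associator_pure[OF A A A x y d]
          by (subst tensor_map_pure[OF A AA A A id \<mu>_linear]) (use x y d in auto)
        ultimately show "\<mu> (tensor_map A A \<mu> (\<lambda>a. a) (pure AB A (pure A A x y) d)) =
          \<mu> (tensor_map A A (\<lambda>a. a) \<mu> (associator A A A (pure AB A (pure A A x y) d)))"
          using m_assoc[OF x y d] by simp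
      qed
    qed
  qed
  have left: "\<mu> (tensor_map A A \<eta> (\<lambda>a. a) u) = left_unitor A u"
    if u: "u \<in> carrier (tensor_module ?I A)" for u
    unfolding left_unitor_def
  proof (rule tensor_eqI[OF u I A A
        complex_linear_comp[OF tensor_map_linear[OF I A A A \<eta>_linear id] \<mu>_linear]
        tensor_lift_linear[OF I A A scalar_bilinear]])
    fix z a assume z: "z \<in> carrier ?I" and a: "a \<in> carrier A"
    show "\<mu> (tensor_map A A \<eta> (\<lambda>a. a) (pure ?I A z a)) =
        tensor_lift A (\<lambda>z a. [:z:] \<odot> a) (pure ?I A z a)"
      using a by (simp add: tensor_map_pure[OF I A A A \<eta>_linear id z a]
          tensor_lift_pure[OF I A A scalar_bilinear z a] m_scale_left e_left)
  qed
  have right: "\<mu> (tensor_map A A (\<lambda>a. a) \<eta> u) = right_unitor A u"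
    if u: "u \<in> carrier (tensor_module A ?I)" for u
    unfolding right_unitor_def
  proof (rule tensor_eqI[OF u A I A
        complex_linear_comp[OF tensor_map_linear[OF A I A A id \<eta>_linear] \<mu>_linear]
        tensor_lift_linear[OF A I A complex_bilinear_swap[OF scalar_bilinear]]])
    fix a z assume a: "a \<in> carrier A" and z: "z \<in> carrier ?I"
    show "\<mu> (tensor_map A A (\<lambda>a. a) \<eta> (pure A ?I a z)) =
        tensor_lift A (\<lambda>a z. [:z:] \<odot> a) (pure A ?I a z)"
      using a m_comm[OF a e_closed]
      by (simp add: tensor_map_pure[OF A I A A id \<eta>_linear a z]
          tensor_lift_pure[OF A I A complex_bilinear_swap[OF scalar_bilinear] a z] m_scale_right e_left)
  qed
  show ?thesis
    unfolding comm_halgebra_def Let_def halgebra_of_def halgebra.simps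
    using module_axioms \<mu>_hom \<eta>_hom sym assoc left right by blast
qed

lemma hprod_halgebra_of:
  "a \<in> carrier A \<Longrightarrow> b \<in> carrier A \<Longrightarrow> hprod (halgebra_of A (\<cdot>) e) a b = a \<cdot> b"
  by (simp add: hprod_def halgebra_of_def)

end

locale halgebra_obj =
  fixes \<A> :: "'v halgebra"
  assumes alg: "comm_halgebra \<A>"
begin

abbreviation "A \<equiv> hmod \<A>"
abbreviation "\<mu> \<equiv> hmult \<A>"
abbreviation "\<eta> \<equiv> hunit \<A>"

lemma halgebra_laws:
  shows mod: "Module.module H_ring A"
    and \<mu>_hom: "\<mu> \<in> lin_hom H_ring (tensor_module A A) A"
    and \<eta>_hom: "\<eta> \<in> lin_hom H_ring unit_module A"
    and sym: "u \<in> carrier (tensor_module A A) \<Longrightarrow> \<mu> (symmetry A A u) = \<mu> u"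
    and assoc: "v \<in> carrier (tensor_module (tensor_module A A) A) \<Longrightarrow>
           \<mu> (tensor_map A A \<mu> (\<lambda>a. a) v) = \<mu> (tensor_map A A (\<lambda>a. a) \<mu> (associator A A A v))"
    and left: "w \<in> carrier (tensor_module unit_module A) \<Longrightarrow>
           \<mu> (tensor_map A A \<eta> (\<lambda>a. a) w) = left_unitor A w"
  using alg by (auto simp: comm_halgebra_def Let_def)

sublocale two_hmodules A A
  using mod by (simp add: two_hmodules_def hmodule_def)

lemma \<mu>_linear: "complex_linear AB A \<mu>"
  by (rule lin_hom_complex_linear) (rule \<mu>_hom)

lemma \<eta>_linear: "complex_linear unit_module A \<eta>"
  by (rule lin_hom_complex_linear) (rule \<eta>_hom)

lemma hprod_bilinear: "complex_bilinear A A A (hprod \<A>)"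
  using complex_bilinear_post[OF pure_bilinear \<mu>_linear] by (simp add: hprod_def[abs_def])

lemma comm_diff_algebra: "comm_diff_algebra A (hprod \<A>) (\<eta> 1)"
proof -
  note S = A.complex_space_axioms
  note AA = tensor_complex_space and id = complex_linear_id[of A]
  note I = unit_module_space
  note b1 = complex_linearD[OF complex_bilinearD(1)[OF hprod_bilinear]]
  have e: "\<eta> 1 \<in> carrier A" using complex_linearD(1)[OF \<eta>_linear] by simp
  have "comm_diff_algebra_axioms A (hprod \<A>) (\<eta> 1)"
  proof
    show "\<eta> 1 \<in> carrier A" by (rule e)
    fix a b assume a: "a \<in> carrier A" and b: "b \<in> carrier A"
    have p: "pure A A a b \<in> carrier AB" using a b by simp
    show "hprod \<A> a b \<in> carrier A" using b1(1)[OF b a] .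
    show "hprod \<A> ([:c:] \<odot>\<^bsub>A\<^esub> a) b = [:c:] \<odot>\<^bsub>A\<^esub> hprod \<A> a b" for c
      using b1(3)[OF b a] .
    show "hprod \<A> (a \<oplus>\<^bsub>A\<^esub> a') b = hprod \<A> a b \<oplus>\<^bsub>A\<^esub> hprod \<A> a' b" if "a' \<in> carrier A" for a'
      using b1(2)[OF b a that] .
    show "hprod \<A> a b = hprod \<A> b a"
      using sym[OF p] by (simp add: hprod_def symmetry_pure[OF S S a b])
    show "[:0, 1:] \<odot>\<^bsub>A\<^esub> hprod \<A> a b =
        hprod \<A> ([:0, 1:] \<odot>\<^bsub>A\<^esub> a) b \<oplus>\<^bsub>A\<^esub> hprod \<A> a ([:0, 1:] \<odot>\<^bsub>A\<^esub> b)"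
    proof -
      have "[:0, 1:] \<odot>\<^bsub>A\<^esub> \<mu> (pure A A a b) = \<mu> ([:0, 1:] \<odot>\<^bsub>AB\<^esub> pure A A a b)"
        using \<mu>_hom p by (simp add: lin_hom_def)
      then show ?thesis
        using a b by (simp add: hprod_def T_pure complex_linearD(2)[OF \<mu>_linear])
    qed
    show "hprod \<A> (\<eta> 1) a = a"
    proof -
      have z: "(1::complex) \<in> carrier unit_module" by simp
      show ?thesis
        using left[OF pure_in_tensor[OF I S z a]] a
        by (simp add: hprod_def tensor_map_pure[OF I S S S \<eta>_linear id z a] left_unitor_def
            tensor_lift_pure[OF I S S A.scalar_bilinear z a] one_pCons[symmetric])
    qed
    fix d assume d: "d \<in> carrier A"
    have "pure AB A (pure A A a b) d \<in> carrier (tensor_module AB A)"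
      by (rule pure_in_tensor[OF AA S p d])
    from assoc[OF this] show "hprod \<A> (hprod \<A> a b) d = hprod \<A> a (hprod \<A> b d)"
      using b d by (simp add: hprod_def tensor_map_pure[OF AA S S S \<mu>_linear id p d]
        associator_pure[OF S S S a b d] tensor_map_pure[OF S AA S S id \<mu>_linear a])
  qed
  then show ?thesis by (simp add: comm_diff_algebra_def A.hmodule_axioms)
qed

end

text \<open>A multiplication is linear and extensional, and a unit map is linear; so they are determined by the
  products of elements and by the unit element.\<close>

lemma halgebra_eqI:
  assumes "comm_halgebra \<A>" "comm_halgebra \<B>" and mod: "hmod \<A> = hmod \<B>"
    and prod: "\<And>a b. a \<in> carrier (hmod \<B>) \<Longrightarrow> b \<in> carrier (hmod \<B>) \<Longrightarrow> hprod \<A> a b = hprod \<B> a b"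
    and unit: "hunit \<A> 1 = hunit \<B> 1"
  shows "\<A> = \<B>"
proof (rule halgebra.equality)
  interpret A: halgebra_obj \<A> by (rule halgebra_obj.intro) fact
  interpret B: halgebra_obj \<B> by (rule halgebra_obj.intro) fact
  note S = B.A.complex_space_axioms
  show "hmult \<A> = hmult \<B>"
  proof (rule extensionalityI)
    show "hmult \<B> \<in> extensional (carrier B.AB)"
      using B.\<mu>_hom by (simp add: lin_hom_def PiE_def)
    show "hmult \<A> \<in> extensional (carrier B.AB)"
      using A.\<mu>_hom by (simp add: lin_hom_def PiE_def mod)
    fix u assume u: "u \<in> carrier B.AB"
    show "hmult \<A> u = hmult \<B> u"
      by (rule tensor_eqI[OF u S S S A.\<mu>_linear[unfolded mod] B.\<mu>_linear])
        (use prod in \<open>simp add: hprod_def mod\<close>)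
  qed
  show "hunit \<A> = hunit \<B>"
  proof
    fix z
    show "hunit \<A> z = hunit \<B> z"
      using complex_linearD(3)[OF A.\<eta>_linear, of 1 z] complex_linearD(3)[OF B.\<eta>_linear, of 1 z]
      by (simp add: counit_def mod unit)
  qed
qed (simp_all add: mod)

text \<open>Both sides of the multiplicativity condition are linear on the tensor product, so it may be
  tested on pure tensors.\<close>

lemma halgebra_hom_iff:
  assumes "comm_halgebra \<A>" "comm_halgebra \<B>"
  shows "f \<in> halgebra_hom \<A> \<B> \<longleftrightarrow> f \<in> lin_hom H_ring (hmod \<A>) (hmod \<B>) \<and>
    (\<forall>a\<in>carrier (hmod \<A>). \<forall>b\<in>carrier (hmod \<A>). f (hprod \<A> a b) = hprod \<B> (f a) (f b)) \<and>
    f (hunit \<A> 1) = hunit \<B> 1"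
proof (cases "f \<in> lin_hom H_ring (hmod \<A>) (hmod \<B>)")
  case True
  interpret A: halgebra_obj \<A> by (rule halgebra_obj.intro) fact
  interpret B: halgebra_obj \<B> by (rule halgebra_obj.intro) fact
  note f = lin_hom_complex_linear[OF True]
  note S = A.A.complex_space_axioms and S' = B.A.complex_space_axioms
  let ?ff = "tensor_map B.A B.A f f"
  note m = tensor_map[OF S S S' S' f f]
  have "(\<forall>u\<in>carrier A.AB. f (A.\<mu> u) = B.\<mu> (?ff u)) \<longleftrightarrow>
    (\<forall>a\<in>carrier A.A. \<forall>b\<in>carrier A.A. f (hprod \<A> a b) = hprod \<B> (f a) (f b))" (is "?L \<longleftrightarrow> ?R")
  proof
    assume L: ?L
    show ?R
    proof (intro ballI)
      fix a b assume ab: "a \<in> carrier A.A" "b \<in> carrier A.A"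
      show "f (hprod \<A> a b) = hprod \<B> (f a) (f b)"
        using L[rule_format, of "pure A.A A.A a b"] ab by (simp add: hprod_def m(2))
    qed
  next
    assume R: ?R
    show ?L
    proof
      fix u assume u: "u \<in> carrier A.AB"
      show "f (A.\<mu> u) = B.\<mu> (?ff u)"
        by (rule tensor_eqI[OF u S S S' complex_linear_comp[OF A.\<mu>_linear f]
              complex_linear_comp[OF m(1) B.\<mu>_linear]])
          (use R in \<open>simp add: hprod_def m(2)\<close>)
    qed
  qed
  moreover have "(\<forall>z. f (A.\<eta> z) = B.\<eta> z) \<longleftrightarrow> f (A.\<eta> 1) = B.\<eta> 1"
  proof
    assume 1: "f (A.\<eta> 1) = B.\<eta> 1"
    show "\<forall>z. f (A.\<eta> z) = B.\<eta> z"
    proof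
      fix z
      show "f (A.\<eta> z) = B.\<eta> z"
        using complex_linearD(3)[OF complex_linear_comp[OF A.\<eta>_linear f], of 1 z]
          complex_linearD(3)[OF B.\<eta>_linear, of 1 z] 1 by (simp add: counit_def)
    qed
  qed simp
  ultimately show ?thesis using True by (simp add: halgebra_hom_def)
qed (simp add: halgebra_hom_def)

section \<open>Holomorphic vertex algebras and commutative differential algebras\<close>

text \<open>Evaluation of \<open>h\<close> at the endomorphism \<open>T\<close> by Horner's scheme: it avoids sums over the degree, so
  that the module axioms are inductions over the polynomial.\<close>

definition hact :: "'v vertex_algebra \<Rightarrow> complex poly \<Rightarrow> 'v \<Rightarrow> 'v" where
  "hact V h v = fold_coeffs (\<lambda>c w. c \<odot>\<^bsub>V\<^esub> v \<oplus>\<^bsub>V\<^esub> trans V w) h \<zero>\<^bsub>V\<^esub>"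

text \<open>Here and in the next definition the operations are undefined outside the carrier, so that the
  result is normalized and the two constructions are inverse to each other as maps of records.\<close>

definition hmodule_of :: "'v vertex_algebra \<Rightarrow> 'v hmodule" where
  "hmodule_of V = \<lparr>carrier = carrier V, monoid.mult = undefined, one = undefined,
     zero = \<zero>\<^bsub>V\<^esub>, add = ring.add V,
     module.smult = (\<lambda>h v. if v \<in> carrier V then hact V h v else undefined)\<rparr>"

definition vertex_algebra_of :: "'v hmodule \<Rightarrow> ('v \<Rightarrow> 'v \<Rightarrow> 'v) \<Rightarrow> 'v \<Rightarrow> 'v vertex_algebra" where
  "vertex_algebra_of A m e = \<lparr>carrier = carrier A, monoid.mult = undefined, one = undefined,
     zero = \<zero>\<^bsub>A\<^esub>, add = ring.add A,
     module.smult = (\<lambda>c v. if v \<in> carrier A then [:c:] \<odot>\<^bsub>A\<^esub> v else undefined),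
     trans = (\<lambda>v\<in>carrier A. [:0, 1:] \<odot>\<^bsub>A\<^esub> v), vac = e,
     vop = (\<lambda>a b. if a \<in> carrier A \<and> b \<in> carrier A
       then (\<lambda>n. m (divpow n \<odot>\<^bsub>A\<^esub> a) b) else undefined)\<rparr>"

lemma (in abelian_group) minus_eq_zeroD:
  assumes "x \<ominus> y = \<zero>" "x \<in> carrier G" "y \<in> carrier G"
  shows "x = y"
proof -
  have "x = (x \<ominus> y) \<oplus> y" using assms(2,3) by (simp add: minus_eq a_assoc l_neg)
  then show ?thesis unfolding assms(1) using assms(3) by simp
qed

lemma (in abelian_group) minus_eqD:
  assumes "x \<ominus> y = z" "x \<in> carrier G" "y \<in> carrier G"
  shows "x = z \<oplus> y"
  unfolding assms(1)[symmetric] using assms(2,3) by (simp add: minus_eq a_assoc l_neg)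

text \<open>Multiplication by \<open>x - y\<close> is injective on power series: comparing coefficients of
  \<open>x ^ m * y ^ (n + 1)\<close> expresses the coefficients in row \<open>m\<close> through those in row \<open>m - 1\<close>.\<close>

lemma mult_x_minus_y_eq_0D:
  assumes "abelian_group V" "\<And>m n. F m n \<in> carrier V"
    and 0: "mult_x_minus_y V F = (\<lambda>m n. \<zero>\<^bsub>V\<^esub>)"
  shows "F m n = \<zero>\<^bsub>V\<^esub>"
proof -
  interpret abelian_group V by fact
  have step: "(if m = 0 then \<zero>\<^bsub>V\<^esub> else F (m - 1) (Suc n)) = F m n" for m n
  proof (rule minus_eq_zeroD)
    show "(if m = 0 then \<zero>\<^bsub>V\<^esub> else F (m - 1) (Suc n)) \<ominus>\<^bsub>V\<^esub> F m n = \<zero>\<^bsub>V\<^esub>"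
      using fun_cong[OF fun_cong[OF 0, of m], of "Suc n"]
      by (simp only: mult_x_minus_y_def nat.distinct if_False diff_Suc_1)
  qed (simp_all add: assms(2))
  show ?thesis
  proof (induction m arbitrary: n)
    case 0
    show ?case using step[of 0 n] by simp
  next
    case (Suc m)
    show ?case using step[of "Suc m" n] Suc[of "Suc n"] by simp
  qed
qed

lemma funpow_mult_x_minus_y_eq_0D:
  assumes V: "abelian_group V"
  shows "(\<And>m n. F m n \<in> carrier V) \<Longrightarrow> (mult_x_minus_y V ^^ N) F = (\<lambda>m n. \<zero>\<^bsub>V\<^esub>) \<Longrightarrow> F m n = \<zero>\<^bsub>V\<^esub>"
proof (induction N arbitrary: F m n)
  case 0
  then show ?case by (simp add: fun_eq_iff)
next
  case (Suc N)
  interpret abelian_group V by fact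
  have "mult_x_minus_y V F m n \<in> carrier V" for m n
    using Suc.prems(1) by (simp add: mult_x_minus_y_def)
  moreover have "(mult_x_minus_y V ^^ N) (mult_x_minus_y V F) = (\<lambda>m n. \<zero>\<^bsub>V\<^esub>)"
    using Suc.prems(2) by (simp add: funpow_swap1)
  ultimately have "mult_x_minus_y V F m n = \<zero>\<^bsub>V\<^esub>" for m n
    by (rule Suc.IH)
  then have "mult_x_minus_y V F = (\<lambda>m n. \<zero>\<^bsub>V\<^esub>)" by (simp add: fun_eq_iff)
  then show ?case by (rule mult_x_minus_y_eq_0D[OF V Suc.prems(1)])
qed

locale holomorphic = 
  fixes V :: "'v vertex_algebra" (structure)
  assumes hva: "holomorphic_vertex_algebra V"
begin

sublocale Module.module C_ring V
  using hva by (simp add: holomorphic_vertex_algebra_def)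

lemma C_ring_simps [simp]:
  "carrier C_ring = UNIV" "g \<otimes>\<^bsub>C_ring\<^esub> h = g * h" "g \<oplus>\<^bsub>C_ring\<^esub> h = g + h"
  "\<one>\<^bsub>C_ring\<^esub> = 1" "\<zero>\<^bsub>C_ring\<^esub> = 0"
  by (auto simp: ring_of_type_algebra_def)

lemma zero_smult [simp]: "x \<in> carrier V \<Longrightarrow> 0 \<odot> x = \<zero>"
  using smult_l_null[of x, unfolded C_ring_simps] .

lemma one_smult [simp]: "x \<in> carrier V \<Longrightarrow> 1 \<odot> x = x"
  using smult_one[of x, unfolded C_ring_simps] .

abbreviation "T \<equiv> trans V"
abbreviation "Y a b n \<equiv> vop V a b n"
abbreviation "vacuum \<equiv> vac V"
abbreviation "A \<equiv> hmodule_of V"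
abbreviation "dot a b \<equiv> Y a b 0"

lemma T_hom: "T \<in> lin_hom C_ring V V"
  using hva by (simp add: holomorphic_vertex_algebra_def)

lemma T_simps [simp]:
  assumes "x \<in> carrier V"
  shows "T x \<in> carrier V" "y \<in> carrier V \<Longrightarrow> T (x \<oplus> y) = T x \<oplus> T y" "T (c \<odot> x) = c \<odot> T x"
  using T_hom assms by (auto simp: lin_hom_def)

lemma T_0 [simp]: "T \<zero> = \<zero>"
  using T_simps(3)[of \<zero> 0] by simp

lemma vac_closed [simp]: "vacuum \<in> carrier V"
  and T_vac: "T vacuum = \<zero>"
  and Y_vac_left: "a \<in> carrier V \<Longrightarrow> Y vacuum a n = (if n = 0 then a else \<zero>)"
  and Y_vac_right: "a \<in> carrier V \<Longrightarrow> Y a vacuum 0 = a"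
  and translation: "a \<in> carrier V \<Longrightarrow> b \<in> carrier V \<Longrightarrow>
      T (Y a b n) \<ominus> Y a (T b) n = of_nat (n + 1) \<odot> Y a b (n + 1)"
  using hva by (simp_all add: holomorphic_vertex_algebra_def)

lemma Y_left:
  assumes b: "b \<in> carrier V" and a: "a \<in> carrier V"
  shows Y_closed [simp]: "Y a b n \<in> carrier V"
    and Y_add_left: "a' \<in> carrier V \<Longrightarrow> Y (a \<oplus> a') b n = Y a b n \<oplus> Y a' b n"
    and Y_scale_left: "Y (c \<odot> a) b n = c \<odot> Y a b n"
proof -
  have "(\<lambda>a\<in>carrier V. Y a b n) \<in> lin_hom C_ring V V"
    using hva b by (simp add: holomorphic_vertex_algebra_def)
  then show "Y a b n \<in> carrier V"
    "a' \<in> carrier V \<Longrightarrow> Y (a \<oplus> a') b n = Y a b n \<oplus> Y a' b n" "Y (c \<odot> a) b n = c \<odot> Y a b n"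
    using a by (auto simp: lin_hom_def restrict_PiE_iff)
qed

lemma Y_zero_right: 
  assumes a: "a \<in> carrier V"
  shows "Y a \<zero> n = \<zero>"
proof -
  have "(\<lambda>b\<in>carrier V. Y a b n) \<in> lin_hom C_ring V V"
    using hva a by (simp add: holomorphic_vertex_algebra_def)
  then have "\<forall>r\<in>carrier C_ring. \<forall>x\<in>carrier V.
      (\<lambda>b\<in>carrier V. Y a b n) (r \<odot> x) = r \<odot> (\<lambda>b\<in>carrier V. Y a b n) x"
    unfolding lin_hom_def by blast
  from bspec[OF bspec[OF this, of 0], of \<zero>] show ?thesis using a by simp
qed

lemma Y_commute:
  assumes "a \<in> carrier V" "b \<in> carrier V" "c \<in> carrier V"
  shows "Y a (Y b c n) m = Y b (Y a c m) n"
proof -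
  have "\<forall>a\<in>carrier V. \<forall>b\<in>carrier V. \<exists>N. \<forall>c\<in>carrier V.
      (mult_x_minus_y V ^^ N) (vcommutator V a b c) = (\<lambda>m n. \<zero>)"
    using hva unfolding holomorphic_vertex_algebra_def by (elim conjE)
  from bspec[OF bspec[OF this assms(1)] assms(2)] assms(3)
  obtain N where N: "(mult_x_minus_y V ^^ N) (vcommutator V a b c) = (\<lambda>m n. \<zero>)"
    by blast
  have "vcommutator V a b c m n = \<zero>"
    by (rule funpow_mult_x_minus_y_eq_0D[OF abelian_group_axioms _ N])
      (use assms in \<open>simp add: vcommutator_def\<close>)
  then have "Y a (Y b c n) m \<ominus> Y b (Y a c m) n = \<zero>"
    by (simp add: vcommutator_def)
  then show ?thesis
    by (rule minus_eq_zeroD) (use assms in simp_all)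
qed

lemma hact_0 [simp]: "hact V 0 v = \<zero>"
  by (simp add: hact_def)

lemma hact_pCons: "v \<in> carrier V \<Longrightarrow> hact V (pCons c h) v = c \<odot> v \<oplus> T (hact V h v)"
  by (cases "h = 0"; cases "c = 0") (simp_all add: hact_def)

lemma hact_closed [simp]: "v \<in> carrier V \<Longrightarrow> hact V h v \<in> carrier V"
  by (induction h) (simp_all add: hact_pCons)

lemma hact_add_right:
  "v \<in> carrier V \<Longrightarrow> w \<in> carrier V \<Longrightarrow> hact V h (v \<oplus> w) = hact V h v \<oplus> hact V h w"
  by (induction h) (simp_all add: hact_pCons smult_r_distr a_ac)

lemma hact_add_left:
  "v \<in> carrier V \<Longrightarrow> hact V (g + h) v = hact V g v \<oplus> hact V h v"
  by (induction g h rule: poly_induct2) (simp_all add: hact_pCons smult_l_distr[simplified] a_ac)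

lemma hact_smult: "v \<in> carrier V \<Longrightarrow> hact V (Polynomial.smult c h) v = c \<odot> hact V h v"
  by (induction h) (simp_all add: hact_pCons smult_r_distr smult_assoc1[simplified])

lemma hact_mult: "v \<in> carrier V \<Longrightarrow> hact V (g * h) v = hact V g (hact V h v)"
  by (induction g) (simp_all add: hact_pCons hact_add_left hact_smult)

lemma A_simps [simp]:
  "carrier A = carrier V" "\<zero>\<^bsub>A\<^esub> = \<zero>" "x \<oplus>\<^bsub>A\<^esub> y = x \<oplus> y"
  "x \<in> carrier V \<Longrightarrow> h \<odot>\<^bsub>A\<^esub> x = hact V h x"
  by (simp_all add: hmodule_of_def)

lemma hact_const [simp]: "x \<in> carrier V \<Longrightarrow> hact V [:c:] x = c \<odot> x"
  by (simp add: hact_pCons)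

lemma hact_1 [simp]: "x \<in> carrier V \<Longrightarrow> hact V 1 x = x"
  using hact_const[of x 1] smult_one[of x] by (simp add: one_pCons)

lemma hact_generator [simp]: "x \<in> carrier V \<Longrightarrow> hact V [:0, 1:] x = T x"
  using smult_one[of x] by (simp add: hact_pCons)

lemma A_module: "Module.module H_ring A"
proof (rule moduleI)
  show "cring H_ring" by (rule cring_from_type_algebra)
  show "abelian_group A"
  proof (rule abelian_groupI)
    fix x assume "x \<in> carrier A"
    then show "\<exists>y\<in>carrier A. y \<oplus>\<^bsub>A\<^esub> x = \<zero>\<^bsub>A\<^esub>"
      by (auto intro!: bexI[of _ "\<ominus> x"] simp: l_neg)
  qed (simp_all add: a_ac)
qed (simp_all add: ring_of_type_algebra_def hact_add_left hact_add_right hact_mult)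

sublocale H: hmodule A
  by (simp add: hmodule_def A_module)

lemma prod_comm: "a \<in> carrier V \<Longrightarrow> b \<in> carrier V \<Longrightarrow> dot a b = dot b a"
  using Y_commute[of a b vacuum 0 0] by (simp add: Y_vac_right)

text \<open>Since \<open>T\<close> kills the vacuum, the translation axiom is a recursion for the coefficients of
  \<open>Y(a,x)|0>\<close>, and the divided powers of \<open>T\<close> satisfy the same recursion.\<close>

lemma Y_vac_divpow: "a \<in> carrier V \<Longrightarrow> Y a vacuum n = divpow n \<odot>\<^bsub>A\<^esub> a"
proof (induction n)
  case 0
  then show ?case by (simp add: Y_vac_right)
next
  case (Suc n)
  let ?c = "of_nat (Suc n) :: complex"
  have "[:?c:] \<odot>\<^bsub>A\<^esub> Y a vacuum (Suc n) = T (Y a vacuum n)"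
    using minus_eqD[OF translation[OF Suc.prems vac_closed, of n]] Suc.prems
    by (simp add: T_vac Y_zero_right)
  also have "\<dots> = [:0, 1:] \<odot>\<^bsub>A\<^esub> (divpow n \<odot>\<^bsub>A\<^esub> a)"
    using Suc by simp
  also have "\<dots> = [:?c:] \<odot>\<^bsub>A\<^esub> (divpow (Suc n) \<odot>\<^bsub>A\<^esub> a)"
    using Suc.prems by (simp only: H.act_mult[symmetric] divpow_Suc A_simps(1))
  finally show ?case
    by (rule H.scale_cancel) (use Suc.prems in \<open>simp_all del: of_nat_Suc\<close>)
qed

text \<open>Commuting the two fields in \<open>Y(a,x)b = Y(a,x) b\<^sub>0 1 = b\<^sub>0 Y(a,x) 1 = (e\<^sup>x\<^sup>T a) b\<close> expresses every
  coefficient through the product; \<open>b\<^sub>0\<close> denotes the constant term of \<open>Y(b,y)\<close> and \<open>1\<close> the vacuum.\<close>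

lemma Y_eq_prod:
  assumes "a \<in> carrier V" "b \<in> carrier V"
  shows "Y a b n = dot (divpow n \<odot>\<^bsub>A\<^esub> a) b"
proof -
  have "Y a b n = Y a (Y b vacuum 0) n" using assms by (simp add: Y_vac_right)
  also have "\<dots> = Y b (Y a vacuum n) 0" using assms by (simp add: Y_commute)
  also have "\<dots> = dot (divpow n \<odot>\<^bsub>A\<^esub> a) b"
    using assms by (simp add: Y_vac_divpow prod_comm)
  finally show ?thesis .
qed

sublocale CDA: comm_diff_algebra A "\<lambda>a b. dot a b" vacuum
proof
  fix a b assume "a \<in> carrier A" "b \<in> carrier A"
  then have a: "a \<in> carrier V" and b: "b \<in> carrier V" by simp_all
  show "dot a b \<in> carrier A" using a b by simp
  show "dot a b = dot b a" using a b by (rule prod_comm)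
  show "dot vacuum a = a" using a by (simp add: Y_vac_left)
  show "dot ([:c:] \<odot>\<^bsub>A\<^esub> a) b = [:c:] \<odot>\<^bsub>A\<^esub> dot a b" for c
    using a b by (simp add: Y_scale_left)
  show "dot (a \<oplus>\<^bsub>A\<^esub> a') b = dot a b \<oplus>\<^bsub>A\<^esub> dot a' b" if "a' \<in> carrier A" for a'
    using a b that by (simp add: Y_add_left)
  show "dot (dot a b) d = dot a (dot b d)" if "d \<in> carrier A" for d
  proof -
    have d: "d \<in> carrier V" using that by simp
    have "dot (dot a b) d = dot d (dot a b)" using a b d by (simp add: prod_comm)
    also have "\<dots> = dot a (dot d b)" using a b d by (simp add: Y_commute)
    also have "dot d b = dot b d" using d b by (rule prod_comm)
    finally show ?thesis .
  qed
  have "divpow (Suc 0) = [:0, 1:]" by (simp add: divpow_def monom_Suc)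
  then have "Y a b (Suc 0) = dot (T a) b"
    using Y_eq_prod[OF a b, of "Suc 0"] a by simp
  then show "[:0, 1:] \<odot>\<^bsub>A\<^esub> dot a b = dot ([:0, 1:] \<odot>\<^bsub>A\<^esub> a) b \<oplus>\<^bsub>A\<^esub> dot a ([:0, 1:] \<odot>\<^bsub>A\<^esub> b)"
    using minus_eqD[OF translation[OF a b, of 0]] a b smult_one[of "dot (T a) b"] by simp
qed simp

lemma normalized_A:
  assumes "normalized V"
  shows "normalized A"
  using assms by (auto simp: normalized_def hmodule_of_def extensional_def)

lemma vertex_algebra_of_cong:
  assumes "normalized V" "case_prod (vop V) \<in> extensional (carrier V \<times> carrier V)"
    and m: "\<And>a b. a \<in> carrier V \<Longrightarrow> b \<in> carrier V \<Longrightarrow> m a b = dot a b"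
  shows "vertex_algebra_of A m vacuum = V"
proof (rule vertex_algebra.equality)
  show "module.smult (vertex_algebra_of A m vacuum) = module.smult V"
    using assms(1) by (auto simp: vertex_algebra_of_def normalized_def extensional_def fun_eq_iff)
  show "trans (vertex_algebra_of A m vacuum) = trans V"
    using T_hom by (auto simp: vertex_algebra_of_def lin_hom_def fun_eq_iff PiE_def extensional_def)
  show "vop (vertex_algebra_of A m vacuum) = vop V"
  proof (intro ext)
    fix a b n
    show "vop (vertex_algebra_of A m vacuum) a b n = vop V a b n"
    proof (cases "a \<in> carrier V \<and> b \<in> carrier V")
      case True
      then have "hact V (divpow n) a \<in> carrier V" by simp
      with True show ?thesis
        using Y_eq_prod[of a b n] by (simp add: vertex_algebra_of_def m)
    next
      case False
      then have "vop V a b = undefined" using assms(2) by (auto simp: extensional_def)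
      with False show ?thesis by (auto simp: vertex_algebra_of_def)
    qed
  qed
qed (use assms(1) in \<open>simp_all add: vertex_algebra_of_def hmodule_of_def normalized_def\<close>)

end

context comm_diff_algebra
begin

abbreviation "V \<equiv> vertex_algebra_of A (\<cdot>) e"

lemma V_simps [simp]:
  "carrier V = carrier A" "\<zero>\<^bsub>V\<^esub> = \<zero>" "x \<oplus>\<^bsub>V\<^esub> y = x \<oplus> y"
  "x \<in> carrier A \<Longrightarrow> c \<odot>\<^bsub>V\<^esub> x = [:c:] \<odot> x"
  "trans V = (\<lambda>v\<in>carrier A. [:0, 1:] \<odot> v)" "vac V = e"
  "a \<in> carrier A \<Longrightarrow> b \<in> carrier A \<Longrightarrow> vop V a b n = (divpow n \<odot> a) \<cdot> b"
  by (simp_all add: vertex_algebra_of_def)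

lemma V_minus [simp]:
  "x \<in> carrier A \<Longrightarrow> y \<in> carrier A \<Longrightarrow> x \<ominus>\<^bsub>V\<^esub> y = x \<ominus> y"
  by (simp add: a_minus_def a_inv_def vertex_algebra_of_def m_inv_def)

lemma V_module: "Module.module C_ring V"
proof (rule moduleI)
  show "cring C_ring" by (rule cring_from_type_algebra)
  show "abelian_group V"
  proof (rule abelian_groupI)
    fix x assume "x \<in> carrier V"
    then show "\<exists>y\<in>carrier V. y \<oplus>\<^bsub>V\<^esub> x = \<zero>\<^bsub>V\<^esub>"
      by (auto intro!: bexI[of _ "\<ominus> x"] simp: l_neg)
  qed (simp_all add: a_ac)
qed (simp_all add: ring_of_type_algebra_def scale_l_distr scale_r_distr scale_assoc one_pCons[symmetric])

lemma Y_commutes: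
  assumes "a \<in> carrier A" "b \<in> carrier A" "d \<in> carrier A"
  shows "a \<cdot> (b \<cdot> d) = b \<cdot> (a \<cdot> d)"
  using assms by (simp add: m_assoc[symmetric] m_comm[of a b])

lemma holomorphic_vertex_algebra_of: "holomorphic_vertex_algebra V"
proof -
  have "trans V \<in> lin_hom C_ring V V"
    using complex_linearD[OF act_linear[of "[:0, 1:]"]]
    by (auto simp: lin_hom_def)
  moreover have "(\<lambda>a\<in>carrier V. vop V a b n) \<in> lin_hom C_ring V V" if "b \<in> carrier V" for b n
    using that by (auto simp: lin_hom_def act_add_right m_add_left m_scale_left
        act_commute[of _ "divpow n"])
  moreover have "(\<lambda>b\<in>carrier V. vop V a b n) \<in> lin_hom C_ring V V" if "a \<in> carrier V" for a n
    using that by (auto simp: lin_hom_def m_add_right m_scale_right)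
  moreover have "trans V (vac V) = \<zero>\<^bsub>V\<^esub>"
    by (simp add: T_e)
  moreover have "vop V (vac V) a n = (if n = 0 then a else \<zero>\<^bsub>V\<^esub>)" if "a \<in> carrier V" for a n
  proof -
    have "0 \<odot> e = \<zero>" by simp
    moreover have "\<zero> \<cdot> a = \<zero>"
      using m_scale_left[of \<zero> a 0] that by simp
    ultimately show ?thesis
      using that act_e[of "divpow n"]
      by (auto simp: e_left counit_def divpow_def)
  qed
  moreover have "vop V a (vac V) 0 = a" if "a \<in> carrier V" for a
    using that m_comm[of a e] by (simp add: e_left)
  moreover have "trans V (vop V a b n) \<ominus>\<^bsub>V\<^esub> vop V a (trans V b) n
        = of_nat (n + 1) \<odot>\<^bsub>V\<^esub> vop V a b (n + 1)" if "a \<in> carrier V" "b \<in> carrier V" for a b n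
  proof -
    have a: "a \<in> carrier A" and b: "b \<in> carrier A" using that by simp_all
    have "[:0, 1:] \<odot> ((divpow n \<odot> a) \<cdot> b) =
        ([:0, 1:] \<odot> (divpow n \<odot> a)) \<cdot> b \<oplus> (divpow n \<odot> a) \<cdot> ([:0, 1:] \<odot> b)"
      using a b by (simp add: T_derivation)
    also have "[:0, 1:] \<odot> (divpow n \<odot> a) = [:of_nat (Suc n):] \<odot> (divpow (Suc n) \<odot> a)"
      using a by (simp only: act_mult[symmetric] divpow_Suc)
    finally show ?thesis
      using a b by (simp add: m_scale_left minus_eq a_assoc r_neg del: of_nat_Suc)
  qed
  moreover have "\<exists>N. \<forall>c\<in>carrier V. (mult_x_minus_y V ^^ N) (vcommutator V a b c) = (\<lambda>m n. \<zero>\<^bsub>V\<^esub>)"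
    if "a \<in> carrier V" "b \<in> carrier V" for a b
    \<comment> \<open>multiplication operators commute, so no power of \<open>x - y\<close> has to be multiplied with\<close>
  proof (rule exI[of _ 0], intro ballI)
    fix c assume "c \<in> carrier V"
    with that show "(mult_x_minus_y V ^^ 0) (vcommutator V a b c) = (\<lambda>m n. \<zero>\<^bsub>V\<^esub>)"
      by (simp add: vcommutator_def fun_eq_iff Y_commutes[of "divpow _ \<odot> a" "divpow _ \<odot> b" c]
          minus_eq r_neg)
  qed
  ultimately show ?thesis
    unfolding holomorphic_vertex_algebra_def using V_module by (simp del: V_simps add: V_simps(1,6))
qed

lemma hact_V: "v \<in> carrier A \<Longrightarrow> hact V h v = h \<odot> v"
proof (induction h)
  case (pCons c h)
  interpret W: holomorphic V by (rule holomorphic.intro) (rule holomorphic_vertex_algebra_of)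
  show ?case
    using pCons W.hact_pCons[of v c h] act_pCons[of v c h] by simp
qed (simp add: hact_def)

lemma hmodule_of_V:
  assumes "normalized A"
  shows "hmodule_of V = A"
proof (rule module.equality)
  show "module.smult (hmodule_of V) = module.smult A"
  proof (intro ext)
    fix h v
    have "h \<odot> v = undefined" if "v \<notin> carrier A"
      using assms that by (auto simp: normalized_def extensional_def)
    then show "h \<odot>\<^bsub>hmodule_of V\<^esub> v = h \<odot> v"
      by (simp add: hmodule_of_def hact_V)
  qed
  show "ring.add (hmodule_of V) = ring.add A"
    by (simp add: hmodule_of_def vertex_algebra_of_def)
qed (use assms in \<open>simp_all add: hmodule_of_def normalized_def\<close>)

lemma normalized_V:
  assumes "normalized A"
  shows "normalized V"
  using assms by (auto simp: normalized_def vertex_algebra_of_def extensional_def)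

lemma vop_extensional: "case_prod (vop V) \<in> extensional (carrier V \<times> carrier V)"
  by (auto simp: vertex_algebra_of_def extensional_def)

end

section \<open>The isomorphism of categories\<close>

text \<open>A bijection on objects under which the hom-sets, identities and compositions agree literally is
  an isomorphism of categories, and it carries the category axioms along.\<close>

lemma isomorphic_categoriesI:
  fixes C :: "('o, 'm) category" and D :: "('p, 'm) category"
  assumes C: "is_category C"
    and Fo: "\<And>x. x \<in> Obj C \<Longrightarrow> Fo x \<in> Obj D" and Go: "\<And>y. y \<in> Obj D \<Longrightarrow> Go y \<in> Obj C"
    and GF: "\<And>x. x \<in> Obj C \<Longrightarrow> Go (Fo x) = x" and FG: "\<And>y. y \<in> Obj D \<Longrightarrow> Fo (Go y) = y"
    and Hom: "\<And>x y. x \<in> Obj C \<Longrightarrow> y \<in> Obj C \<Longrightarrow> Hom D (Fo x) (Fo y) = Hom C x y"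
    and Idt: "\<And>x. x \<in> Obj C \<Longrightarrow> Idt D (Fo x) = Idt C x"
    and Cmp: "\<And>x y z g f. x \<in> Obj C \<Longrightarrow> y \<in> Obj C \<Longrightarrow> z \<in> Obj C \<Longrightarrow>
      Cmp D (Fo x) (Fo y) (Fo z) g f = Cmp C x y z g f"
  shows "isomorphic_categories C D"
proof -
  have Obj: "Obj D = Fo ` Obj C"
  proof
    show "Obj D \<subseteq> Fo ` Obj C"
    proof
      fix y assume "y \<in> Obj D"
      then have "Fo (Go y) \<in> Fo ` Obj C" by (intro imageI Go)
      with FG[OF \<open>y \<in> Obj D\<close>] show "y \<in> Fo ` Obj C" by simp
    qed
  qed (use Fo in blast)
  have "is_category D"
    using C unfolding is_category_def Obj by (simp add: Hom Idt Cmp)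
  moreover have "is_functor C D Fo (\<lambda>x y f. f)"
    using C by (auto simp: is_functor_def is_category_def Fo Hom Idt Cmp)
  moreover have "is_functor D C Go (\<lambda>x y f. f)"
    unfolding is_functor_def Obj by (auto simp: GF Hom Idt Cmp)
  moreover have "\<exists>Fm Gm. is_functor C D Fo Fm \<and> is_functor D C Go Gm \<and>
      (\<forall>x\<in>Obj C. \<forall>y\<in>Obj C. \<forall>f\<in>Hom C x y. Gm (Fo x) (Fo y) (Fm x y f) = f) \<and>
      (\<forall>x\<in>Obj D. \<forall>y\<in>Obj D. \<forall>f\<in>Hom D x y. Fm (Go x) (Go y) (Gm x y f) = f)"
    using calculation by (intro exI[of _ "\<lambda>x y f. f"]) auto
  ultimately show ?thesis
    unfolding isomorphic_categories_def using C GF FG by blast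
qed

lemma HolVA_is_category: "is_category HolVA"
proof -
  have add: "x \<oplus>\<^bsub>V\<^esub> y \<in> carrier V" "r \<odot>\<^bsub>V\<^esub> x \<in> carrier V" "vac V \<in> carrier V" "trans V x \<in> carrier V"
    "vop V x y n \<in> carrier V"
    if "V \<in> Obj HolVA" "x \<in> carrier V" "y \<in> carrier V"
    for V :: "'v vertex_algebra" and x y r n
  proof -
    interpret holomorphic V
      using that by (simp add: HolVA_def holomorphic_def)
    show "x \<oplus>\<^bsub>V\<^esub> y \<in> carrier V" "r \<odot>\<^bsub>V\<^esub> x \<in> carrier V" "vac V \<in> carrier V" "trans V x \<in> carrier V"
      "vop V x y n \<in> carrier V"
      using that by simp_all
  qed
  have vac: "vac V \<in> carrier V" if "V \<in> Obj HolVA" for V :: "'v vertex_algebra"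
    using that by (simp add: HolVA_def holomorphic_vertex_algebra_def)
  have maps: "f \<in> carrier V \<rightarrow>\<^sub>E carrier W" if "f \<in> va_hom V W" for f and V W :: "'v vertex_algebra"
    using that by (simp add: va_hom_def lin_hom_def)
  have id: "(\<lambda>a\<in>carrier V. a) \<in> va_hom V V" if V: "V \<in> Obj HolVA" for V :: "'v vertex_algebra"
    using add[OF V] vac[OF V] by (auto simp: va_hom_def lin_hom_def)
  have comp: "compose (carrier U) g f \<in> va_hom U W"
    if U: "U \<in> Obj HolVA" and "f \<in> va_hom U V" "g \<in> va_hom V W"
    for f g and U V W :: "'v vertex_algebra"
  proof -
    have "f x \<in> carrier V" if "x \<in> carrier U" for x
      using that maps[OF \<open>f \<in> va_hom U V\<close>] by auto
    then show ?thesis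
      using that add[OF U] vac[OF U]
      by (auto simp: va_hom_def lin_hom_def compose_def)
  qed
  have unit: "compose (carrier V) f (\<lambda>a\<in>carrier V. a) = f"
      "compose (carrier V) (\<lambda>a\<in>carrier W. a) f = f"
    if "f \<in> va_hom V W" for f and V W :: "'v vertex_algebra"
    using maps[OF that] by (auto simp: compose_def fun_eq_iff PiE_def extensional_def Pi_def)
  have assoc: "compose (carrier U) (compose (carrier V) h g) f = compose (carrier U) h (compose (carrier U) g f)"
    if "f \<in> va_hom U V" for f g h and U V :: "'v vertex_algebra"
    using maps[OF that] by (auto simp: compose_def fun_eq_iff)
  have simps: "Hom HolVA = va_hom" "Idt HolVA = (\<lambda>V. \<lambda>a\<in>carrier V. a)"
      "Cmp HolVA = (\<lambda>U V W g f. compose (carrier U) g f)"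
    by (simp_all add: HolVA_def)
  show ?thesis
    unfolding is_category_def simps by (intro conjI ballI) (rule id unit comp assoc; assumption)+
qed

definition algebra_of :: "'v vertex_algebra \<Rightarrow> 'v halgebra" where
  "algebra_of V = halgebra_of (hmodule_of V) (\<lambda>a b. vop V a b 0) (vac V)"

definition vertex_of :: "'v halgebra \<Rightarrow> 'v vertex_algebra" where
  "vertex_of \<A> = vertex_algebra_of (hmod \<A>) (hprod \<A>) (hunit \<A> 1)"

lemma algebra_of_simps [simp]: "hmod (algebra_of V) = hmodule_of V"
  by (simp add: algebra_of_def halgebra_of_def)

lemma (in holomorphic) algebra_of:
  shows "comm_halgebra (algebra_of V)"
    and "a \<in> carrier V \<Longrightarrow> b \<in> carrier V \<Longrightarrow> hprod (algebra_of V) a b = dot a b"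
    and "hunit (algebra_of V) 1 = vacuum"
  using CDA.comm_halgebra_halgebra_of CDA.hprod_halgebra_of[of a b]
  by (simp_all add: algebra_of_def halgebra_of_def)

text \<open>A complex linear map is \<open>\<complex>[T]\<close>-linear if it commutes with \<open>T\<close>, and a \<open>\<complex>[T]\<close>-linear map that respects
  the products respects \<open>Y\<close>, whose coefficients are products with divided powers of \<open>T\<close>.\<close>

lemma va_hom_eq_halgebra_hom:
  assumes "holomorphic_vertex_algebra V" "holomorphic_vertex_algebra W"
  shows "halgebra_hom (algebra_of V) (algebra_of W) = va_hom V W"
proof (rule Set.set_eqI)
  fix f
  interpret V: holomorphic V by (rule holomorphic.intro) fact
  interpret W: holomorphic W by (rule holomorphic.intro) fact
  note iff = halgebra_hom_iff[OF V.algebra_of(1) W.algebra_of(1), of f]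
  show "f \<in> halgebra_hom (algebra_of V) (algebra_of W) \<longleftrightarrow> f \<in> va_hom V W"
  proof
    assume "f \<in> halgebra_hom (algebra_of V) (algebra_of W)"
    with iff have f: "f \<in> lin_hom H_ring V.A W.A" and vac: "f (vac V) = vac W"
      and m: "\<forall>a\<in>carrier V. \<forall>b\<in>carrier V. f (hprod (algebra_of V) a b) = hprod (algebra_of W) (f a) (f b)"
      by (simp_all add: V.algebra_of W.algebra_of)
    from f have ext: "f \<in> carrier V \<rightarrow>\<^sub>E carrier W" by (simp add: lin_hom_def)
    then have cl: "f x \<in> carrier W" if "x \<in> carrier V" for x using that by auto
    have add: "f (x \<oplus>\<^bsub>V\<^esub> y) = f x \<oplus>\<^bsub>W\<^esub> f y" if "x \<in> carrier V" "y \<in> carrier V" for x y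
      using f that by (simp add: lin_hom_def)
    have h: "f (hact V h x) = hact W h (f x)" if "x \<in> carrier V" for h x
      using f that cl[OF that] by (simp add: lin_hom_def)
    have "f (c \<odot>\<^bsub>V\<^esub> x) = c \<odot>\<^bsub>W\<^esub> f x" if "x \<in> carrier V" for c x
      using h[OF that, of "[:c:]"] that cl[OF that] by simp
    moreover have "f (trans V x) = trans W (f x)" if "x \<in> carrier V" for x
      using h[OF that, of "[:0, 1:]"] that cl[OF that] by simp
    moreover have "f (vop V a b n) = vop W (f a) (f b) n" if "a \<in> carrier V" "b \<in> carrier V" for a b n
    proof -
      have p: "f (vop V x b 0) = vop W (f x) (f b) 0" if "x \<in> carrier V" for x
        using m that \<open>b \<in> carrier V\<close> cl by (simp add: V.algebra_of W.algebra_of)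
      show ?thesis
        using that cl p[of "hact V (divpow n) a"] V.Y_eq_prod[of a b n] W.Y_eq_prod[of "f a" "f b" n]
        by (simp add: h)
    qed
    ultimately show "f \<in> va_hom V W"
      using ext add vac by (simp add: va_hom_def lin_hom_def)
  next
    assume f: "f \<in> va_hom V W"
    then have ext: "f \<in> carrier V \<rightarrow>\<^sub>E carrier W" by (simp add: va_hom_def lin_hom_def)
    then have cl: "f x \<in> carrier W" if "x \<in> carrier V" for x using that by auto
    have add: "f (x \<oplus>\<^bsub>V\<^esub> y) = f x \<oplus>\<^bsub>W\<^esub> f y" if "x \<in> carrier V" "y \<in> carrier V" for x y
      using f that by (simp add: va_hom_def lin_hom_def)
    have scale: "f (c \<odot>\<^bsub>V\<^esub> x) = c \<odot>\<^bsub>W\<^esub> f x" if "x \<in> carrier V" for c x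
      using f that by (simp add: va_hom_def lin_hom_def)
    have T: "f (trans V x) = trans W (f x)" if "x \<in> carrier V" for x
      using f that by (simp add: va_hom_def)
    have "f (hact V h x) = hact W h (f x)" if "x \<in> carrier V" for h x
    proof (induction h)
      case 0
      show ?case using scale[of x 0] that cl[OF that] by simp
    next
      case (pCons c h)
      then show ?case
        using that cl[OF that] by (simp add: V.hact_pCons W.hact_pCons add scale T)
    qed
    then have "f \<in> lin_hom H_ring V.A W.A"
      using ext add cl by (simp add: lin_hom_def)
    moreover have "f (vop V a b 0) = vop W (f a) (f b) 0" if "a \<in> carrier V" "b \<in> carrier V" for a b
      using f that by (simp add: va_hom_def)
    moreover have "f (vac V) = vac W"
      using f by (simp add: va_hom_def)
    ultimately show "f \<in> halgebra_hom (algebra_of V) (algebra_of W)"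
      using iff cl by (simp add: V.algebra_of W.algebra_of)
  qed
qed

theorem claim2p7:
  shows "isomorphic_categories
           (HolVA :: ('v vertex_algebra, 'v \<Rightarrow> 'v) category)
           (HCommAlg :: ('v halgebra, 'v \<Rightarrow> 'v) category)"
proof (rule isomorphic_categoriesI[where Fo = algebra_of and Go = vertex_of])
  show "is_category (HolVA :: ('v vertex_algebra, 'v \<Rightarrow> 'v) category)"
    by (rule HolVA_is_category)
next
  fix V :: "'v vertex_algebra" assume V: "V \<in> Obj HolVA"
  then interpret holomorphic V by (simp add: HolVA_def holomorphic_def)
  from V have norm: "normalized V"
    and ext: "case_prod (vop V) \<in> extensional (carrier V \<times> carrier V)"
    by (simp_all add: HolVA_def)
  show "algebra_of V \<in> Obj HCommAlg"
    using algebra_of(1) normalized_A[OF norm] by (simp add: HCommAlg_def)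
  show "vertex_of (algebra_of V) = V"
    using vertex_algebra_of_cong[OF norm ext algebra_of(2)]
    by (simp add: vertex_of_def algebra_of(3))
  show "Idt HCommAlg (algebra_of V) = Idt HolVA V"
    by (simp add: HCommAlg_def HolVA_def)
next
  fix \<A> :: "'v halgebra" assume "\<A> \<in> Obj HCommAlg"
  then have alg: "comm_halgebra \<A>" and norm: "normalized (hmod \<A>)"
    by (simp_all add: HCommAlg_def)
  interpret \<A>: halgebra_obj \<A> by (rule halgebra_obj.intro) (rule alg)
  interpret D: comm_diff_algebra "hmod \<A>" "hprod \<A>" "hunit \<A> 1"
    by (rule \<A>.comm_diff_algebra)
  show W: "vertex_of \<A> \<in> Obj HolVA"
    using D.holomorphic_vertex_algebra_of D.normalized_V[OF norm] D.vop_extensional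
    by (simp add: HolVA_def vertex_of_def del: D.V_simps)
  show "algebra_of (vertex_of \<A>) = \<A>"
  proof -
    interpret W: holomorphic "vertex_of \<A>"
      using W by (simp add: HolVA_def holomorphic_def)
    show ?thesis
    proof (rule halgebra_eqI[OF W.algebra_of(1) alg])
      show "hmod (algebra_of (vertex_of \<A>)) = hmod \<A>"
        using D.hmodule_of_V[OF norm] by (simp add: vertex_of_def)
      show "hunit (algebra_of (vertex_of \<A>)) 1 = hunit \<A> 1"
        using W.algebra_of(3) by (simp add: vertex_of_def)
      fix a b assume "a \<in> carrier (hmod \<A>)" "b \<in> carrier (hmod \<A>)"
      then show "hprod (algebra_of (vertex_of \<A>)) a b = hprod \<A> a b"
        using W.algebra_of(2)[of a b] by (simp add: vertex_of_def)
    qed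
  qed
next
  fix V W :: "'v vertex_algebra" assume "V \<in> Obj HolVA" "W \<in> Obj HolVA"
  then show "Hom HCommAlg (algebra_of V) (algebra_of W) = Hom HolVA V W"
    by (simp add: HCommAlg_def HolVA_def va_hom_eq_halgebra_hom)
next
  fix U V W :: "'v vertex_algebra" and f g :: "'v \<Rightarrow> 'v"
  have "carrier (hmodule_of U) = carrier U" by (simp add: hmodule_of_def)
  then show "Cmp HCommAlg (algebra_of U) (algebra_of V) (algebra_of W) g f = Cmp HolVA U V W g f"
    by (simp add: HCommAlg_def HolVA_def)
qed

end
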